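(* Let $\mu$ be a locally finite Borel measure on $\mathbb R^d$ and $\mathscr D$ a dyadic lattice on $\mathbb R^d$. Let $0<\eta<1$, let $\mathcal S\subseteq\mathscr D$ be $\eta$-sparse, let $\Gamma\subseteq\mathscr D\times\mathscr D$ be a relation of complexity at most $\kappa\in\mathbb N_0$, let $1<p<\infty$, and let $\sigma,\omega$ be weights. Then, for all $f\in L^p_\sigma$ and $g\in L^{p'}_\omega$, $$|\mathcal C_{\mathcal S,\Gamma}(f\sigma,g\omega)|\le C\,[\omega,\sigma]_{\mathcal A_{p,\Gamma}(\mu)}^{1/p}\Bigl([\sigma]_{A_\infty^{\mathscr D}(\mu)}^{1/p}+[\omega]_{A_\infty^{\mathscr D}(\mu)}^{1/p'}\Bigr)\|f\|_{L^p_\sigma}\|g\|_{L^{p'}_\omega},$$ where $C$ depends only on $p,d,\kappa,\eta$.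
   Context: A dyadic lattice $\mathscr D$ is a collection of (half-open, axis-parallel) cubes in $\mathbb R^d$ such that: every dyadic child ($2^d$ children obtained by halving sides) of a cube of $\mathscr D$ is in $\mathscr D$; any two cubes of $\mathscr D$ have a common dyadic ancestor in $\mathscr D$; every compact set is contained in a cube of $\mathscr D$. $Q^{(r)}$ is the $r$-th dyadic ancestor of $Q$, $Q^{(0)}=Q$. Convention: cubes of zero $\mu$-measure are omitted from all averages, sums and suprema. $\langle f\rangle_Q^\mu:=\mu(Q)^{-1}\int_Qf\,\mathrm d\mu$. A weight is a locally $\mu$-integrable function that is positive $\mu$-a.e.; $\omega(Q)=\int_Q\omega\,\mathrm d\mu$, $L^p_\omega:=L^p(\mathbb R^d,\omega\,\mathrm d\mu)$, $1/p+1/p'=1$. $\mathcal S\subseteq\mathscr D$ is $\eta$-sparse (with respect to $\mu$) if for each $Q\in\mathcal S$ there is a measurable $E_Q\subseteq Q$ with $\mu(E_Q)\ge\eta\mu(Q)$, the sets $E_Q$ being pairwise disjoint. Dyadic distance: $\operatorname{dist}_{\mathscr D}(Q,P):=\min\{r+t:r,t\in\mathbb N_0,\ Q^{(r)}=P^{(t)}\}$ ($=\infty$ if there is no common ancestor). $\Gamma$ has complexity at most $\kappa$ if $\operatorname{dist}_{\mathscr D}(Q,P)\le\kappa$ for every $(Q,P)\in\Gamma$. Form: $\mathcal C_{\mathcal S,\Gamma}(f,g):=\sum_{Q,P\in\mathcal S,\ (Q,P)\in\Gamma}\langle f\rangle_Q^\mu\langle g\rangle_P^\mu\,c_{Q,P}$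 with $c_{Q,P}:=\min\{\mu(Q),\mu(P)\}$. Characteristics: $[\omega,\sigma]_{\mathcal A_{p,\Gamma}(\mu)}:=\sup_{(Q,P)\in\Gamma}\frac{c_{Q,P}^p}{\mu(Q)\mu(P)^{p-1}}\langle\omega\rangle_P^\mu(\langle\sigma\rangle_Q^\mu)^{p-1}$; $[v]_{A_\infty^{\mathscr D}(\mu)}:=\sup_{Q\in\mathscr D}\frac1{v(Q)}\int_QM_{\mathscr D}(v\mathbf 1_Q)\,\mathrm d\mu$, where $M_{\mathscr D}f(x):=\sup_{Q\in\mathscr D}\langle|f|\rangle_Q^\mu\mathbf 1_Q(x)$. *)

theory Defs
  imports "HOL-Analysis.Analysis"
begin

definition cube :: "real ^ 'd \<Rightarrow> real \<Rightarrow> (real ^ 'd) set" where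
  "cube a l = {x. \<forall>i. a $ i \<le> x $ i \<and> x $ i < a $ i + l}"

definition cubes :: "(real ^ 'd) set set" where
  "cubes = {cube a l | a l. 0 < l}"

definition dyadic_children :: "(real ^ 'd) set \<Rightarrow> (real ^ 'd) set set" where
  "dyadic_children Q =
     {cube (a + (l / 2) *\<^sub>R e) (l / 2) | a l e. 0 < l \<and> Q = cube a l \<and> (\<forall>i. e $ i \<in> {0, 1})}"

primrec dyadic_descendants :: "nat \<Rightarrow> (real ^ 'd) set \<Rightarrow> (real ^ 'd) set set" where
  "dyadic_descendants 0 Q = {Q}"
| "dyadic_descendants (Suc n) Q = (\<Union>P \<in> dyadic_descendants n Q. dyadic_children P)"

definition dyadic_lattice :: "(real ^ 'd) set set \<Rightarrow> bool" where
  "dyadic_lattice D \<longleftrightarrow>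
     D \<subseteq> cubes \<and>
     (\<forall>Q\<in>D. dyadic_children Q \<subseteq> D) \<and>
     (\<forall>Q\<in>D. \<forall>P\<in>D. \<exists>R\<in>D. \<exists>r t. Q \<in> dyadic_descendants r R \<and> P \<in> dyadic_descendants t R) \<and>
     (\<forall>K. compact K \<longrightarrow> (\<exists>Q\<in>D. K \<subseteq> Q))"

text \<open>
  For \<open>Q\<close> in a dyadic lattice \<open>D\<close> the cube described here exists and is unique; see
  \<open>dyadic_ancestor_ex1\<close> below.
\<close>
definition dyadic_ancestor :: "(real ^ 'd) set set \<Rightarrow> nat \<Rightarrow> (real ^ 'd) set \<Rightarrow> (real ^ 'd) set" where
  "dyadic_ancestor D r Q = (THE R. R \<in> D \<and> Q \<in> dyadic_descendants r R)"

text \<open>The infimum of the empty set in \<^typ>\<open>enat\<close> is \<open>\<infinity>\<close>.\<close>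
definition dyadic_dist :: "(real ^ 'd) set set \<Rightarrow> (real ^ 'd) set \<Rightarrow> (real ^ 'd) set \<Rightarrow> enat" where
  "dyadic_dist D Q P =
     Inf {enat (r + t) | r t. dyadic_ancestor D r Q = dyadic_ancestor D t P}"

definition complexity_at_most ::
    "(real ^ 'd) set set \<Rightarrow> ((real ^ 'd) set \<times> (real ^ 'd) set) set \<Rightarrow> nat \<Rightarrow> bool" where
  "complexity_at_most D \<Gamma> \<kappa> \<longleftrightarrow> (\<forall>(Q, P)\<in>\<Gamma>. dyadic_dist D Q P \<le> enat \<kappa>)"

definition locally_finite_borel :: "(real ^ 'd) measure \<Rightarrow> bool" where
  "locally_finite_borel M \<longleftrightarrow>
     sets M = sets borel \<and> (\<forall>x. \<exists>U. open U \<and> x \<in> U \<and> emeasure M U < \<infinity>)"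

definition weight :: "(real ^ 'd) measure \<Rightarrow> (real ^ 'd \<Rightarrow> real) \<Rightarrow> bool" where
  "weight M v \<longleftrightarrow>
     v \<in> borel_measurable M \<and> (\<forall>K. compact K \<longrightarrow> set_integrable M K v) \<and> (AE x in M. 0 < v x)"

abbreviation weighted :: "(real ^ 'd) measure \<Rightarrow> (real ^ 'd \<Rightarrow> real) \<Rightarrow> (real ^ 'd) measure" where
  "weighted M v \<equiv> density M (\<lambda>x. ennreal (v x))"

definition in_Lp :: "real \<Rightarrow> 'a measure \<Rightarrow> ('a \<Rightarrow> complex) \<Rightarrow> bool" where
  "in_Lp p N f \<longleftrightarrow> f \<in> borel_measurable N \<and> integrable N (\<lambda>x. norm (f x) powr p)"

definition Lp_norm :: "real \<Rightarrow> 'a measure \<Rightarrow> ('a \<Rightarrow> complex) \<Rightarrow> real" where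
  "Lp_norm p N f = (\<integral>x. norm (f x) powr p \<partial>N) powr (1 / p)"

text \<open>Powers of extended nonnegative reals, used for exponents \<open>r > 0\<close> only.\<close>
definition ennreal_powr :: "ennreal \<Rightarrow> real \<Rightarrow> ennreal" where
  "ennreal_powr x r = (if x = \<infinity> then \<infinity> else ennreal (enn2real x powr r))"

definition avg ::
    "(real ^ 'd) measure \<Rightarrow> (real ^ 'd \<Rightarrow> 'b) \<Rightarrow> (real ^ 'd) set \<Rightarrow> 'b::{banach, second_countable_topology}" where
  "avg M f Q = (1 / measure M Q) *\<^sub>R (LINT x:Q|M. f x)"

text \<open>Throughout, cubes of measure zero are omitted from averages, sums and suprema.\<close>

definition eta_sparse ::
    "(real ^ 'd) measure \<Rightarrow> real \<Rightarrow> (real ^ 'd) set set \<Rightarrow> bool" where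
  "eta_sparse M \<eta> S \<longleftrightarrow>
     (\<exists>E. (\<forall>Q\<in>S. E Q \<in> sets M \<and> E Q \<subseteq> Q \<and> emeasure M (E Q) \<ge> ennreal \<eta> * emeasure M Q) \<and>
          disjoint_family_on E S)"

definition min_measure ::
    "(real ^ 'd) measure \<Rightarrow> (real ^ 'd) set \<Rightarrow> (real ^ 'd) set \<Rightarrow> real" where
  "min_measure M Q P = min (measure M Q) (measure M P)"

definition form_pairs ::
    "(real ^ 'd) measure \<Rightarrow> (real ^ 'd) set set \<Rightarrow> ((real ^ 'd) set \<times> (real ^ 'd) set) set
      \<Rightarrow> ((real ^ 'd) set \<times> (real ^ 'd) set) set" where
  "form_pairs M S \<Gamma> =
     {(Q, P) \<in> \<Gamma>. Q \<in> S \<and> P \<in> S \<and> 0 < emeasure M Q \<and> 0 < emeasure M P}"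

definition form_term ::
    "(real ^ 'd) measure \<Rightarrow> (real ^ 'd \<Rightarrow> complex) \<Rightarrow> (real ^ 'd \<Rightarrow> complex)
      \<Rightarrow> (real ^ 'd) set \<times> (real ^ 'd) set \<Rightarrow> complex" where
  "form_term M f g = (\<lambda>(Q, P). avg M f Q * avg M g P * of_real (min_measure M Q P))"

definition sparse_form ::
    "(real ^ 'd) measure \<Rightarrow> (real ^ 'd) set set \<Rightarrow> ((real ^ 'd) set \<times> (real ^ 'd) set) set
      \<Rightarrow> (real ^ 'd \<Rightarrow> complex) \<Rightarrow> (real ^ 'd \<Rightarrow> complex) \<Rightarrow> complex" where
  "sparse_form M S \<Gamma> f g = infsum (form_term M f g) (form_pairs M S \<Gamma>)"

definition Ap_char ::
    "(real ^ 'd) measure \<Rightarrow> real \<Rightarrow> ((real ^ 'd) set \<times> (real ^ 'd) set) set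
      \<Rightarrow> (real ^ 'd \<Rightarrow> real) \<Rightarrow> (real ^ 'd \<Rightarrow> real) \<Rightarrow> ennreal" where
  "Ap_char M p \<Gamma> \<omega> \<sigma> =
     (SUP (Q, P) \<in> {(Q, P) \<in> \<Gamma>. 0 < emeasure M Q \<and> 0 < emeasure M P}.
        ennreal (min_measure M Q P powr p / (measure M Q * measure M P powr (p - 1))
                 * avg M \<omega> P * avg M \<sigma> Q powr (p - 1)))"

definition dyadic_maximal ::
    "(real ^ 'd) measure \<Rightarrow> (real ^ 'd) set set \<Rightarrow> (real ^ 'd \<Rightarrow> real) \<Rightarrow> real ^ 'd \<Rightarrow> ennreal" where
  "dyadic_maximal M D f x =
     (SUP Q \<in> {Q \<in> D. 0 < emeasure M Q}.
        (\<integral>\<^sup>+y\<in>Q. ennreal \<bar>f y\<bar> \<partial>M) / emeasure M Q * indicator Q x)"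

definition Ainf_char ::
    "(real ^ 'd) measure \<Rightarrow> (real ^ 'd) set set \<Rightarrow> (real ^ 'd \<Rightarrow> real) \<Rightarrow> ennreal" where
  "Ainf_char M D v =
     (SUP Q \<in> {Q \<in> D. 0 < emeasure M Q}.
        (\<integral>\<^sup>+x\<in>Q. dyadic_maximal M D (\<lambda>y. v y * indicator Q y) x \<partial>M)
          / ennreal (LINT x:Q|M. v x))"

lemma cube_inject:
  fixes a a' :: "real ^ 'd"
  assumes "0 < l" "0 < l'" "cube a l = cube a' l'"
  shows "a = a'" "l = l'"
proof -
  have "a \<in> cube a' l'" "a' \<in> cube a l"
    using assms by (auto simp: cube_def set_eq_iff)
  then show eq: "a = a'"
    by (auto simp: cube_def vec_eq_iff intro: antisym)
  have less: False if "0 < k" "k < k'" "cube a k = cube a k'" for k k'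
  proof -
    have "(\<chi> i. a $ i + k) \<in> cube a k'" "(\<chi> i. a $ i + k) \<notin> cube a k"
      using that(1,2) by (auto simp: cube_def)
    then show False using that(3) by simp
  qed
  show "l = l'"
    using less[of l l'] less[of l' l] assms eq by (metis linorder_neqE_linordered_idom)
qed

lemma dyadic_children_cube:
  assumes "0 < l"
  shows "dyadic_children (cube a l) =
    {cube (a + (l / 2) *\<^sub>R e) (l / 2) | e. \<forall>i. e $ i \<in> {0, 1}}"
  unfolding dyadic_children_def using assms cube_inject by blast

lemma dyadic_children_subset:
  assumes "P \<in> dyadic_children Q"
  shows "P \<subseteq> Q"
proof -
  obtain a l e where *: "0 < l" "Q = cube a l" "\<forall>i. e $ i \<in> {0, 1}" "P = cube (a + (l / 2) *\<^sub>R e) (l / 2)"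
    using assms by (auto simp: dyadic_children_def)
  show ?thesis
  proof
    fix x assume x: "x \<in> P"
    have "a $ i \<le> x $ i \<and> x $ i < a $ i + l" for i
    proof -
      have "a $ i + l / 2 * e $ i \<le> x $ i" "x $ i < a $ i + l / 2 * e $ i + l / 2"
        using x * by (auto simp: cube_def)
      moreover have "e $ i = 0 \<or> e $ i = 1" using * by auto
      ultimately show ?thesis using \<open>0 < l\<close> by auto
    qed
    then show "x \<in> Q" using * by (simp add: cube_def)
  qed
qed

lemma dyadic_children_disjoint:
  assumes "P \<in> dyadic_children Q" "P' \<in> dyadic_children Q" "x \<in> P" "x \<in> P'"
  shows "P = P'"
proof -
  obtain a l e where *: "0 < l" "Q = cube a l" "\<forall>i. e $ i \<in> {0, 1}" "P = cube (a + (l / 2) *\<^sub>R e) (l / 2)"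
    using assms(1) by (auto simp: dyadic_children_def)
  obtain e' where e': "\<forall>i. e' $ i \<in> {0, 1}" "P' = cube (a + (l / 2) *\<^sub>R e') (l / 2)"
    using assms(2) * dyadic_children_cube by blast
  have "e $ i = e' $ i" for i
  proof -
    have "a $ i + l / 2 * e $ i \<le> x $ i" "x $ i < a $ i + l / 2 * e $ i + l / 2"
      "a $ i + l / 2 * e' $ i \<le> x $ i" "x $ i < a $ i + l / 2 * e' $ i + l / 2"
      using assms * e' by (auto simp: cube_def)
    moreover have "e $ i = 0 \<or> e $ i = 1" "e' $ i = 0 \<or> e' $ i = 1" using * e' by auto
    ultimately show ?thesis using \<open>0 < l\<close> by auto
  qed
  then have "e = e'" by (simp add: vec_eq_iff)
  then show ?thesis using * e' by simp
qed

lemma dyadic_descendants_side: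
  assumes "0 < l" "Q \<in> dyadic_descendants n (cube a l)"
  shows "\<exists>b. Q = cube b (l / 2 ^ n)"
  using assms(2)
proof (induction n arbitrary: Q)
  case (Suc n)
  then obtain P where P: "P \<in> dyadic_descendants n (cube a l)" "Q \<in> dyadic_children P" by auto
  then obtain b where "P = cube b (l / 2 ^ n)" using Suc by blast
  then show ?case using P dyadic_children_cube[of "l / 2 ^ n" b] assms(1) by (auto simp: mult.commute)
qed auto

lemma dyadic_descendants_subset:
  "Q \<in> dyadic_descendants n R \<Longrightarrow> Q \<subseteq> R"
  by (induction n arbitrary: Q) (auto dest: dyadic_children_subset)

lemma dyadic_descendants_disjoint:
  assumes "Q \<in> dyadic_descendants n R" "Q' \<in> dyadic_descendants n R" "x \<in> Q" "x \<in> Q'"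
  shows "Q = Q'"
  using assms
proof (induction n arbitrary: Q Q')
  case (Suc n)
  then obtain P P' where P: "P \<in> dyadic_descendants n R" "Q \<in> dyadic_children P"
      "P' \<in> dyadic_descendants n R" "Q' \<in> dyadic_children P'" by auto
  have "P = P'"
    using Suc.IH[OF P(1,3)] Suc.prems(3,4) dyadic_children_subset[OF P(2)] dyadic_children_subset[OF P(4)]
    by blast
  then show ?case using P Suc.prems dyadic_children_disjoint by blast
qed auto

lemma dyadic_descendants_add:
  "dyadic_descendants (m + n) R = (\<Union>T \<in> dyadic_descendants m R. dyadic_descendants n T)"
  by (induction n) auto

lemma dyadic_descendants_lattice:
  assumes "dyadic_lattice D" "R \<in> D" "Q \<in> dyadic_descendants n R"
  shows "Q \<in> D"
  using assms(3) by (induction n arbitrary: Q) (use assms in \<open>auto simp: dyadic_lattice_def\<close>)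

lemma dyadic_lattice_common_ancestor:
  assumes "dyadic_lattice D" "Q \<in> D" "P \<in> D"
  shows "\<exists>R\<in>D. \<exists>r t. Q \<in> dyadic_descendants r R \<and> P \<in> dyadic_descendants t R"
  using assms unfolding dyadic_lattice_def by blast

lemma dyadic_ancestor_ex1:
  fixes D :: "(real ^ 'd) set set"
  assumes D: "dyadic_lattice D" and Q: "Q \<in> D"
  shows "\<exists>!R. R \<in> D \<and> Q \<in> dyadic_descendants r R"
proof (rule ex_ex1I)
  obtain a l where Ql: "Q = cube a l" "0 < l"
    using D Q by (auto simp: dyadic_lattice_def cubes_def)
  then have aQ: "a \<in> Q" by (auto simp: cube_def)
  show "\<exists>R. R \<in> D \<and> Q \<in> dyadic_descendants r R"
  proof -
    define b where "b = (\<chi> i::'d. 2 ^ r * l)"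
    obtain P where P: "P \<in> D" "{0, b} \<subseteq> P"
    proof -
      have "compact {0, b}" by (simp add: finite_imp_compact)
      then have "\<exists>P\<in>D. {0, b} \<subseteq> P" using D unfolding dyadic_lattice_def by blast
      then show thesis using that by blast
    qed
    obtain R m t where R: "R \<in> D" "Q \<in> dyadic_descendants m R" "P \<in> dyadic_descendants t R"
      using dyadic_lattice_common_ancestor[OF D Q P(1)] by blast
    obtain c k where Rc: "R = cube c k" "0 < k"
      using D R by (auto simp: dyadic_lattice_def cubes_def)
    have "{0, b} \<subseteq> R" using P R dyadic_descendants_subset by blast
    then have "c $ i \<le> 0 \<and> 2 ^ r * l < c $ i + k" for i
      using Rc by (simp add: cube_def b_def)
    from this[of undefined] have "2 ^ r * l < k" by linarith
    moreover have "l = k / 2 ^ m"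
      using dyadic_descendants_side[OF Rc(2), of Q m c] R(2) Rc Ql cube_inject(2)[of l "k / 2 ^ m"] by auto
    ultimately have "2 ^ r * l < 2 ^ m * l" by simp
    then have "(2::real) ^ r < 2 ^ m" using Ql by simp
    then have "r < m" by simp
    then obtain T where "T \<in> dyadic_descendants (m - r) R" "Q \<in> dyadic_descendants r T"
      using R(2) dyadic_descendants_add[of "m - r" r R] by auto
    then show ?thesis using dyadic_descendants_lattice[OF D R(1)] by blast
  qed
  fix R R' assume H: "R \<in> D \<and> Q \<in> dyadic_descendants r R" "R' \<in> D \<and> Q \<in> dyadic_descendants r R'"
  obtain T s t where T: "T \<in> D" "R \<in> dyadic_descendants s T" "R' \<in> dyadic_descendants t T"
    using dyadic_lattice_common_ancestor[OF D, of R R'] H by blast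
  obtain c k where Tc: "T = cube c k" "0 < k"
    using D T by (auto simp: dyadic_lattice_def cubes_def)
  have "Q \<in> dyadic_descendants (s + r) T" "Q \<in> dyadic_descendants (t + r) T"
    using H T by (auto simp: dyadic_descendants_add)
  moreover have "l = k / 2 ^ n" if "Q \<in> dyadic_descendants n T" for n
    using dyadic_descendants_side[OF Tc(2), of Q n c] that Tc Ql cube_inject(2)[of l "k / 2 ^ n"] by auto
  ultimately have "k / 2 ^ (s + r) = k / 2 ^ (t + r)" by metis
  then have "(2::real) ^ (s + r) = 2 ^ (t + r)" using Tc(2) by (simp add: frac_eq_eq)
  then have "s = t" by simp
  moreover have "a \<in> R" "a \<in> R'" using H aQ dyadic_descendants_subset by blast+
  ultimately show "R = R'" using T dyadic_descendants_disjoint by blast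
qed

end

theory Submission
  imports Defs
begin

text \<open>
  Write \<open>m = max (\<mu> Q) (\<mu> P)\<close>. Since \<open>min (\<mu> Q) (\<mu> P) / (\<mu> Q * \<mu> P) = 1 / m\<close>, a summand of the form
  is at most the product of the averages of \<open>\<bar>f\<bar>\<close> over \<open>Q\<close> with respect to \<open>\<sigma>\<close> and of \<open>\<bar>g\<bar>\<close> over \<open>P\<close> with
  respect to \<open>\<omega>\<close>, times \<open>\<sigma> Q * \<omega> P / m\<close> (lemma \<open>form_term_le_majorant\<close>), and the joint
  \<open>A\<^sub>p\<close> condition says that \<open>\<omega> P * \<sigma> Q ^ (p - 1) \<le> A * m ^ p\<close> (lemma \<open>Ap_char_pair\<close>).

  Bounded complexity means that every cube has boundedly many partners, so the pairs can be
  coloured with boundedly many colours in such a way that inside a colour class \<open>Q\<close> and \<open>P\<close> determine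
  each other, and cubes of different size on the same side of the class are more than \<open>\<kappa>\<close>
  generations apart (\<open>separated_colouring\<close>). Then a cube \<open>P\<close> of the class that lies strictly inside
  another cube \<open>P'\<close> of the class takes the common ancestor of its pair with it (\<open>near_separated\<close>),
  and hence also its partner \<open>Q\<close>. This makes a class behave almost as if \<open>Q = P\<close>: in
  particular the numbers \<open>m\<close> satisfy a Carleson packing condition (\<open>packing_m\<close>) although \<open>\<mu>\<close> need
  not be doubling.

  The \<open>A\<^sub>p\<close> condition together with Hoelder's inequality would only give the product
  of the two \<open>A\<^sub>\<infinity>\<close> powers. To obtain their sum, let \<open>F \<supseteq> Q\<close> and \<open>G \<supseteq> P\<close> be the stopping
  cubes of \<open>f\<close> and \<open>g\<close>. The pairs of a class are divided into those for which \<open>F\<close> is essentially a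
  function of \<open>G\<close> and those for which \<open>G\<close> is essentially a function of \<open>F\<close>. By symmetry consider the
  former. There it suffices to bound, for fixed \<open>G\<close> and every \<open>T > 0\<close>,
  the sum of \<open>\<sigma> Q * \<omega> P / m\<close> by a multiple of \<open>T * \<omega> G + T powr (1 - p) * A * (\<Sum> \<sigma> Q)\<close>: choosing \<open>T\<close>
  from the averages over \<open>F\<close> and \<open>G\<close> leaves
  two sums, one controlled by the embedding theorem for the stopping cubes of \<open>g\<close>, without any
  packing of \<open>\<omega>\<close>, the other by the embedding theorem for \<open>f\<close> and the packing of \<open>\<sigma>\<close>, which sparseness
  and the \<open>A\<^sub>\<infinity>\<close> constant of \<open>\<sigma>\<close> provide (\<open>Ainf_packing\<close>, \<open>records_embedding\<close>).

  The remaining bound is \<open>layered_sum_bound\<close>. Put \<open>\<lambda> = \<sigma> Q / m\<close>; the \<open>A\<^sub>p\<close> condition becomes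
  \<open>\<omega> P * \<lambda> ^ (p - 1) \<le> A * m\<close>. Pairs with \<open>\<lambda> > T\<close> satisfy \<open>\<lambda> * \<omega> P \<le> T powr (1 - p) * A * \<sigma> Q\<close> outright.
  Among the pairs with \<open>\<lambda> \<le> T\<close>, those with \<open>\<lambda>\<close> of order \<open>2 ^ k\<close> and of equal depth in that layer have
  disjoint cubes \<open>P\<close>, so they contribute at most a multiple of \<open>2 ^ k * \<omega> G\<close>, and the sum over \<open>k\<close> is geometric. To
  sum over the depth as well, \<open>T\<close> is replaced by a threshold that decreases geometrically with the
  depth; the loss on the other side is absorbed by the exponential decay that a Carleson condition
  forces on \<open>m\<close> (\<open>carleson_exponential_depth\<close>).
\<close>

section \<open>Depth in laminar families and Carleson packing\<close>

definition laminar :: "'a set set \<Rightarrow> bool" where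
  "laminar \<Q> \<longleftrightarrow> (\<forall>Q\<in>\<Q>. \<forall>P\<in>\<Q>. Q \<inter> P = {} \<or> Q \<subseteq> P \<or> P \<subseteq> Q)"

lemma laminar_subset: "laminar \<Q> \<Longrightarrow> \<P> \<subseteq> \<Q> \<Longrightarrow> laminar \<P>"
  unfolding laminar_def by blast

lemma laminar_chain:
  assumes "laminar \<Q>" "Q \<in> \<Q>" "P \<in> \<Q>" "X \<noteq> {}" "X \<subseteq> Q" "X \<subseteq> P"
  shows "Q \<subseteq> P \<or> P \<subseteq> Q"
  using assms unfolding laminar_def by blast

definition depth :: "'i set \<Rightarrow> ('i \<Rightarrow> 'a set) \<Rightarrow> 'i \<Rightarrow> nat" where
  "depth I P i = card {j \<in> I. P i \<subset> P j}"

lemma depth_less: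
  assumes "finite I" "j \<in> I" "P i \<subset> P j"
  shows "depth I P j < depth I P i"
  unfolding depth_def
  by (rule psubset_card_mono) (use assms in auto)

lemma disjoint_of_same_depth:
  assumes "finite I" "inj_on P I" "laminar (P ` I)" "i \<in> I" "j \<in> I" "i \<noteq> j"
    and "depth I P i = depth I P j"
  shows "P i \<inter> P j = {}"
proof (rule ccontr)
  assume "P i \<inter> P j \<noteq> {}"
  then have "P i \<subseteq> P j \<or> P j \<subseteq> P i"
    using assms(3-5) unfolding laminar_def by blast
  moreover have "P i \<noteq> P j" using assms by (auto dest: inj_onD)
  ultimately have "P i \<subset> P j \<or> P j \<subset> P i" by blast
  then show False using depth_less[OF assms(1)] assms(4,5,7) by (metis less_irrefl)
qed

lemma depth_image_ancestors:
  assumes "finite I" "inj_on P I" "laminar (P ` I)" "i \<in> I" "P i \<noteq> {}"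
  shows "bij_betw (depth I P) {j \<in> I. P i \<subset> P j} {..<depth I P i}"
proof -
  let ?A = "{j \<in> I. P i \<subset> P j}"
  have inj: "inj_on (depth I P) ?A"
  proof (rule inj_onI)
    fix j k assume jk: "j \<in> ?A" "k \<in> ?A" "depth I P j = depth I P k"
    show "j = k"
    proof (rule ccontr)
      assume "j \<noteq> k"
      then have "P j \<inter> P k = {}"
        using disjoint_of_same_depth[OF assms(1-3)] jk by blast
      then show False using jk assms(5) by blast
    qed
  qed
  have sub: "depth I P ` ?A \<subseteq> {..<depth I P i}"
    by (auto intro!: depth_less[OF assms(1)])
  have "card (depth I P ` ?A) = card {..<depth I P i}"
    using card_image[OF inj] by (simp add: depth_def)
  then have "depth I P ` ?A = {..<depth I P i}"
    using sub by (simp add: card_subset_eq)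
  then show ?thesis using inj by (simp add: bij_betw_def)
qed

text \<open>
  A Carleson condition with constant \<open>K\<close> makes the mass of \<open>m\<close> decay exponentially in the depth. The
  ancestors of \<open>i\<close> have the depths \<open>0, \<dots>, depth i - 1\<close>, so \<open>b ^ depth i\<close> is \<open>1\<close> plus \<open>b - 1\<close> times the sum
  of the \<open>b\<close>-powers of the ancestors. Exchanging the sums bounds the weighted sum \<open>W\<close> by the
  unweighted one plus \<open>(b - 1) * K * W\<close>, and the choice of \<open>b\<close> makes the last term \<open>W / 2\<close>.
\<close>
lemma carleson_exponential_depth:
  fixes m :: "'i \<Rightarrow> real"
  assumes I: "finite I" "inj_on P I" "laminar (P ` I)" "\<And>i. i \<in> I \<Longrightarrow> P i \<noteq> {}"
    and m: "\<And>i. i \<in> I \<Longrightarrow> 0 \<le> m i"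
    and K: "0 < K" "\<And>j. j \<in> I \<Longrightarrow> (\<Sum>i\<in>{i \<in> I. P i \<subseteq> P j}. m i) \<le> K * m j"
    and b: "b = 1 + 1 / (2 * K)"
  shows "(\<Sum>i\<in>I. b ^ depth I P i * m i) \<le> 2 * (\<Sum>i\<in>I. m i)"
proof -
  let ?n = "depth I P"
  let ?W = "\<Sum>i\<in>I. b ^ ?n i * m i"
  have b1: "b > 1" using b K by simp
  have pow: "b ^ ?n i = 1 + (b - 1) * (\<Sum>j\<in>{j \<in> I. P i \<subset> P j}. b ^ ?n j)" if "i \<in> I" for i
  proof -
    have "(\<Sum>j\<in>{j \<in> I. P i \<subset> P j}. b ^ ?n j) = (\<Sum>l<?n i. b ^ l)"
      by (rule sum.reindex_bij_betw[OF depth_image_ancestors]) (use I that in auto)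
    also have "(b - 1) * \<dots> = b ^ ?n i - 1"
      using b1 by (simp add: power_diff_1_eq)
    finally show ?thesis by simp
  qed
  have "?W = (\<Sum>i\<in>I. m i) + (\<Sum>i\<in>I. \<Sum>j\<in>{j \<in> I. P i \<subset> P j}. (b - 1) * b ^ ?n j * m i)"
  proof -
    have "b ^ ?n i * m i = m i + (\<Sum>j\<in>{j \<in> I. P i \<subset> P j}. (b - 1) * b ^ ?n j * m i)" if "i \<in> I" for i
      by (subst pow[OF that]) (simp only: distrib_right sum_distrib_left sum_distrib_right mult_1)
    then show ?thesis by (simp add: sum.distrib[symmetric])
  qed
  also have "(\<Sum>i\<in>I. \<Sum>j\<in>{j \<in> I. P i \<subset> P j}. (b - 1) * b ^ ?n j * m i)
      = (\<Sum>j\<in>I. \<Sum>i\<in>{i \<in> I. P i \<subset> P j}. (b - 1) * b ^ ?n j * m i)"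
    by (rule sum.swap_restrict) (use I in auto)
  also have "\<dots> = (\<Sum>j\<in>I. (b - 1) * b ^ ?n j * (\<Sum>i\<in>{i \<in> I. P i \<subset> P j}. m i))"
    by (simp add: sum_distrib_left)
  also have "\<dots> \<le> (\<Sum>j\<in>I. (b - 1) * b ^ ?n j * (K * m j))"
  proof (intro sum_mono mult_left_mono)
    fix j assume j: "j \<in> I"
    have "(\<Sum>i\<in>{i \<in> I. P i \<subset> P j}. m i) \<le> (\<Sum>i\<in>{i \<in> I. P i \<subseteq> P j}. m i)"
      by (rule sum_mono2) (use I m in auto)
    then show "(\<Sum>i\<in>{i \<in> I. P i \<subset> P j}. m i) \<le> K * m j" using K(2)[OF j] by linarith
  qed (use b1 in auto)
  also have "\<dots> = ?W / 2"
    using K by (simp add: b sum_divide_distrib field_simps)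
  finally show ?thesis by simp
qed

text \<open>
  Sums over distinct integer powers are dominated by their largest term; this replaces every
  geometric series over layers and over chains of stopping cubes below.
\<close>
lemma sum_int_powers_le:
  fixes b x :: real
  assumes "finite Z" "1 < b" "\<And>k. k \<in> Z \<Longrightarrow> b powr real_of_int k \<le> x" "0 \<le> x"
  shows "(\<Sum>k\<in>Z. b powr real_of_int k) \<le> b / (b - 1) * x"
proof (cases "Z = {}")
  case True
  have "0 \<le> b / (b - 1) * x" using assms(2,4) by (intro mult_nonneg_nonneg divide_nonneg_nonneg) auto
  then show ?thesis using True by simp
next
  case False
  define k0 where "k0 = Max Z"
  have k0: "k0 \<in> Z" "\<And>k. k \<in> Z \<Longrightarrow> k \<le> k0"
    using assms(1) False by (auto simp: k0_def)
  define c where "c = 1 / b"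
  have c: "0 < c" "c < 1" using assms by (auto simp: c_def)
  have inj: "inj_on (\<lambda>k. nat (k0 - k)) Z"
    using k0(2) by (intro inj_onI) (metis diff_ge_0_iff_ge eq_diff_iff nat_eq_iff2 diff_left_imp_eq)
  have "(\<Sum>k\<in>Z. b powr real_of_int k) = (\<Sum>k\<in>Z. b powr real_of_int k0 * c ^ nat (k0 - k))"
  proof (rule sum.cong[OF refl])
    fix k assume "k \<in> Z"
    then have "real (nat (k0 - k)) = real_of_int k0 - real_of_int k" using k0(2) by simp
    then have "c ^ nat (k0 - k) = b powr (real_of_int k - real_of_int k0)"
      using c assms(2) by (simp add: c_def powr_realpow[symmetric] powr_divide powr_minus_divide[symmetric])
    then show "b powr real_of_int k = b powr real_of_int k0 * c ^ nat (k0 - k)"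
      by (simp add: powr_add[symmetric])
  qed
  also have "\<dots> = b powr real_of_int k0 * (\<Sum>n\<in>(\<lambda>k. nat (k0 - k)) ` Z. c ^ n)"
    by (simp add: sum.reindex[OF inj] sum_distrib_left)
  also have "\<dots> \<le> b powr real_of_int k0 * (1 / (1 - c))"
  proof (rule mult_left_mono)
    have "(\<Sum>n\<in>(\<lambda>k. nat (k0 - k)) ` Z. c ^ n) \<le> (\<Sum>n. c ^ n)"
      by (rule sum_le_suminf) (use c assms(1) in \<open>auto intro: summable_geometric\<close>)
    then show "(\<Sum>n\<in>(\<lambda>k. nat (k0 - k)) ` Z. c ^ n) \<le> 1 / (1 - c)"
      using c by (simp add: suminf_geometric)
  qed simp
  also have "\<dots> \<le> x * (1 / (1 - c))"
    by (rule mult_right_mono) (use assms(3)[OF k0(1)] c in auto)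
  also have "\<dots> = b / (b - 1) * x"
    using assms(2) by (simp add: c_def field_simps)
  finally show ?thesis .
qed

definition level :: "real \<Rightarrow> int" where
  "level x = \<lfloor>log 2 x\<rfloor>"

lemma level_bounds:
  assumes "0 < x"
  shows "2 powr real_of_int (level x) \<le> x" "x \<le> 2 * 2 powr real_of_int (level x)"
proof -
  show "2 powr real_of_int (level x) \<le> x"
    using assms by (simp add: level_def powr_le_iff le_log_iff[symmetric])
  have "log 2 x \<le> 1 + real_of_int (level x)" unfolding level_def by linarith
  then have "x \<le> 2 powr (1 + real_of_int (level x))"
    using assms by (simp add: log_le_iff)
  then show "x \<le> 2 * 2 powr real_of_int (level x)" by (simp add: powr_add)
qed

section \<open>Layered sums\<close>

text \<open>
  The factor by which the threshold for \<open>\<lambda>\<close> shrinks with each unit of depth. Its power \<open>1 - p\<close> is the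
  base \<open>1 + 1 / (2 * K)\<close> of the exponential weights that a Carleson condition with constant \<open>K\<close>
  tolerates.
\<close>
definition decay_ratio :: "real \<Rightarrow> real \<Rightarrow> real" where
  "decay_ratio p K = (1 + 1 / (2 * K)) powr (- 1 / (p - 1))"

lemma decay_ratio_less_1:
  assumes "1 < p" "0 < K"
  shows "decay_ratio p K < 1"
proof -
  have "(1 + 1 / (2 * K)) powr (- 1 / (p - 1)) < (1 + 1 / (2 * K)) powr 0"
    by (rule powr_less_mono) (use assms in auto)
  moreover have "1 + 1 / (2 * K) \<noteq> 0" using assms by (simp add: add_pos_pos less_imp_neq[symmetric])
  ultimately show ?thesis unfolding decay_ratio_def by (metis powr_zero_eq_one)
qed

text \<open>
  The heart of the two-weight estimate. No packing of \<open>om\<close> is assumed beyond disjoint subfamilies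
  having total mass at most \<open>W\<close>; overlaps of the sets \<open>P i\<close> are controlled through \<open>m\<close> alone. The index
  \<open>i\<close> is called low if \<open>lam i\<close> is at most \<open>T\<close> times the \<open>depth\<close>-th power of the decay ratio, the depth being
  taken within the dyadic layer of \<open>lam i\<close>. Low indices are summed by disjointness inside each layer
  and depth, the others by the hypothesis on \<open>A\<close>.
\<close>
lemma layered_sum_bound:
  fixes lam m om :: "'i \<Rightarrow> real" and P :: "'i \<Rightarrow> 'a set"
  assumes I: "finite I" "inj_on P I" "laminar (P ` I)" "\<And>i. i \<in> I \<Longrightarrow> P i \<noteq> {}"
    and lam: "\<And>i. i \<in> I \<Longrightarrow> 0 < lam i"
    and m: "\<And>i. i \<in> I \<Longrightarrow> 0 \<le> m i"
    and om: "\<And>i. i \<in> I \<Longrightarrow> 0 \<le> om i"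
    and K: "0 < K" "\<And>j. j \<in> I \<Longrightarrow> (\<Sum>i\<in>{i \<in> I. P i \<subseteq> P j}. m i) \<le> K * m j"
    and A: "0 \<le> A" "\<And>i. i \<in> I \<Longrightarrow> om i * lam i powr (p - 1) \<le> A * m i"
    and W: "0 \<le> W" "\<And>J. J \<subseteq> I \<Longrightarrow> disjoint_family_on P J \<Longrightarrow> (\<Sum>i\<in>J. om i) \<le> W"
    and p: "1 < p" and T: "0 < T"
  shows "(\<Sum>i\<in>I. lam i * om i)
    \<le> 4 / (1 - decay_ratio p K) * T * W + 4 * T powr (1 - p) * A * (\<Sum>i\<in>I. lam i * m i)"
proof -
  define r where "r = decay_ratio p K"
  define b where "b = 1 + 1 / (2 * K)"
  define lv where "lv i = level (lam i)" for i
  define Ik where "Ik k = {i \<in> I. lv i = k}" for k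
  define n where "n i = depth (Ik (lv i)) P i" for i
  have b: "1 < b" using K by (simp add: b_def)
  have r01: "0 < r" "r < 1"
  proof -
    show "0 < r" using b by (simp add: r_def decay_ratio_def b_def[symmetric])
    show "r < 1" unfolding r_def by (rule decay_ratio_less_1[OF p K(1)])
  qed
  have rb: "(r ^ k) powr (1 - p) = b ^ k" for k
  proof -
    have "(r ^ k) powr (1 - p) = r powr (real k * (1 - p))"
      using r01 by (simp add: powr_realpow[symmetric] powr_powr)
    also have "\<dots> = b powr (- 1 / (p - 1) * (real k * (1 - p)))"
      by (simp add: r_def decay_ratio_def b_def powr_powr)
    also have "- 1 / (p - 1) * (real k * (1 - p)) = real k"
      using p by (simp add: field_simps)
    finally show ?thesis using b by (simp add: powr_realpow)
  qed
  have lvb: "2 powr real_of_int (lv i) \<le> lam i" "lam i \<le> 2 * 2 powr real_of_int (lv i)" if "i \<in> I" for i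
    using level_bounds[OF lam[OF that]] by (auto simp: lv_def)
  have Iksub: "Ik k \<subseteq> I" for k by (auto simp: Ik_def)
  have Ikf: "finite (Ik k)" "inj_on P (Ik k)" "laminar (P ` Ik k)" for k
    using I(1,2) Iksub[of k] laminar_subset[OF I(3) image_mono[OF Iksub[of k]]]
    by (auto intro: finite_subset inj_on_subset)
  \<comment> \<open>Within a layer \<open>lam\<close> is constant up to a factor 2, so the packing of \<open>m\<close> passes to \<open>lam * m\<close>.\<close>
  have exp_sum: "(\<Sum>i\<in>I. b ^ n i * (lam i * m i)) \<le> 4 * (\<Sum>i\<in>I. lam i * m i)"
  proof -
    have cls: "(\<Sum>i\<in>Ik k. b ^ n i * (lam i * m i)) \<le> 4 * (\<Sum>i\<in>Ik k. lam i * m i)" for k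
    proof -
      have "(\<Sum>i\<in>Ik k. b ^ n i * (lam i * m i))
          \<le> (\<Sum>i\<in>Ik k. 2 * 2 powr real_of_int k * (b ^ depth (Ik k) P i * m i))"
      proof (rule sum_mono)
        fix i assume i: "i \<in> Ik k"
        then have iI: "i \<in> I" and [simp]: "lv i = k" by (auto simp: Ik_def)
        have "b ^ n i * (lam i * m i) = lam i * (b ^ depth (Ik k) P i * m i)" by (simp add: n_def)
        also have "\<dots> \<le> 2 * 2 powr real_of_int k * (b ^ depth (Ik k) P i * m i)"
          by (rule mult_right_mono) (use lvb(2)[OF iI] m[OF iI] b in auto)
        finally show "b ^ n i * (lam i * m i) \<le> 2 * 2 powr real_of_int k * (b ^ depth (Ik k) P i * m i)" .
      qed
      also have "\<dots> = 2 * 2 powr real_of_int k * (\<Sum>i\<in>Ik k. b ^ depth (Ik k) P i * m i)"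
        by (simp add: sum_distrib_left)
      also have "\<dots> \<le> 2 * 2 powr real_of_int k * (2 * (\<Sum>i\<in>Ik k. m i))"
      proof (intro mult_left_mono carleson_exponential_depth[OF Ikf _ _ K(1) _ b_def])
        fix j assume j: "j \<in> Ik k"
        have "(\<Sum>i\<in>{i \<in> Ik k. P i \<subseteq> P j}. m i) \<le> (\<Sum>i\<in>{i \<in> I. P i \<subseteq> P j}. m i)"
          by (rule sum_mono2) (use I m Iksub in auto)
        then show "(\<Sum>i\<in>{i \<in> Ik k. P i \<subseteq> P j}. m i) \<le> K * m j"
          using K(2)[of j] j Iksub by fastforce
      qed (use I(4) m Iksub in auto)
      also have "\<dots> = 4 * (\<Sum>i\<in>Ik k. 2 powr real_of_int k * m i)"
        by (simp add: sum_distrib_left)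
      also have "\<dots> \<le> 4 * (\<Sum>i\<in>Ik k. lam i * m i)"
        using lvb(1) m by (intro mult_left_mono sum_mono mult_right_mono) (auto simp: Ik_def)
      finally show ?thesis .
    qed
    have "(\<Sum>i\<in>I. b ^ n i * (lam i * m i)) = (\<Sum>k\<in>lv ` I. \<Sum>i\<in>Ik k. b ^ n i * (lam i * m i))"
      unfolding Ik_def by (rule sum.image_gen[OF I(1)])
    also have "\<dots> \<le> (\<Sum>k\<in>lv ` I. 4 * (\<Sum>i\<in>Ik k. lam i * m i))"
      by (rule sum_mono) (rule cls)
    also have "\<dots> = 4 * (\<Sum>i\<in>I. lam i * m i)"
      unfolding Ik_def sum_distrib_left[symmetric] by (subst sum.image_gen[OF I(1), of _ lv]) simp
    finally show ?thesis .
  qed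
  define S where "S = {i \<in> I. lam i \<le> T * r ^ n i}"
  have Sf: "finite S" "S \<subseteq> I" using I by (auto simp: S_def)
  have low: "(\<Sum>i\<in>S. lam i * om i) \<le> 4 / (1 - r) * T * W"
  proof -
    have inner: "(\<Sum>i\<in>{i \<in> S. n i = l}. lam i * om i) \<le> 4 * T * W * r ^ l" for l
    proof -
      let ?S = "{i \<in> S. n i = l}"
      have fS: "finite ?S" using Sf by auto
      have one: "(\<Sum>i\<in>{i \<in> ?S. lv i = k}. lam i * om i) \<le> 2 * W * 2 powr real_of_int k" for k
      proof -
        let ?J = "{i \<in> ?S. lv i = k}"
        have "(\<Sum>i\<in>?J. lam i * om i) \<le> (\<Sum>i\<in>?J. 2 * 2 powr real_of_int k * om i)"
          by (intro sum_mono mult_right_mono) (use lvb om Sf in auto)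
        also have "\<dots> = 2 * 2 powr real_of_int k * (\<Sum>i\<in>?J. om i)"
          by (simp add: sum_distrib_left)
        also have "(\<Sum>i\<in>?J. om i) \<le> W"
        proof (rule W(2))
          show "?J \<subseteq> I" using Sf by auto
          show "disjoint_family_on P ?J"
            unfolding disjoint_family_on_def
          proof (intro ballI impI)
            fix i j assume "i \<in> ?J" "j \<in> ?J" "i \<noteq> j"
            then show "P i \<inter> P j = {}"
              using Sf by (intro disjoint_of_same_depth[OF Ikf[of k]]) (auto simp: Ik_def n_def)
          qed
        qed
        finally show ?thesis by (simp add: mult_ac)
      qed
      have "(\<Sum>i\<in>?S. lam i * om i) = (\<Sum>k\<in>lv ` ?S. \<Sum>i\<in>{i \<in> ?S. lv i = k}. lam i * om i)"
        by (rule sum.image_gen[OF fS])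
      also have "\<dots> \<le> (\<Sum>k\<in>lv ` ?S. 2 * W * 2 powr real_of_int k)"
        by (rule sum_mono) (rule one)
      also have "\<dots> = 2 * W * (\<Sum>k\<in>lv ` ?S. 2 powr real_of_int k)"
        by (simp add: sum_distrib_left)
      also have "\<dots> \<le> 2 * W * (2 / (2 - 1) * (T * r ^ l))"
      proof (intro mult_left_mono sum_int_powers_le)
        fix k assume "k \<in> lv ` ?S"
        then obtain i where i: "i \<in> S" "n i = l" "lv i = k" by auto
        then have "lam i \<le> T * r ^ l" by (auto simp: S_def)
        then show "2 powr real_of_int k \<le> T * r ^ l" using lvb(1)[of i] i Sf by auto
      qed (use W T r01 fS in auto)
      finally show ?thesis by (simp add: mult_ac)
    qed
    have "(\<Sum>i\<in>S. lam i * om i) = (\<Sum>l\<in>n ` S. \<Sum>i\<in>{i \<in> S. n i = l}. lam i * om i)"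
      by (rule sum.image_gen[OF Sf(1)])
    also have "\<dots> \<le> (\<Sum>l\<in>n ` S. 4 * T * W * r ^ l)"
      by (rule sum_mono) (rule inner)
    also have "\<dots> = 4 * T * W * (\<Sum>l\<in>n ` S. r ^ l)"
      by (simp add: sum_distrib_left)
    also have "\<dots> \<le> 4 * T * W * (\<Sum>l. r ^ l)"
      by (intro mult_left_mono sum_le_suminf summable_geometric) (use r01 W T Sf in auto)
    also have "\<dots> = 4 / (1 - r) * T * W"
      using r01 by (simp add: suminf_geometric)
    finally show ?thesis .
  qed
  \<comment> \<open>For the other indices \<open>lam i powr (1 - p)\<close> is at most \<open>T powr (1 - p)\<close> times the exponential weight.\<close>
  have high: "lam i * om i \<le> T powr (1 - p) * A * (b ^ n i * (lam i * m i))" if "i \<in> I - S" for i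
  proof -
    have i: "i \<in> I" "T * r ^ n i \<le> lam i" using that by (auto simp: S_def)
    have "lam i * om i = lam i powr (1 - p) * (lam i * (om i * lam i powr (p - 1)))"
      using lam[OF i(1)] by (simp add: powr_diff field_simps)
    also have "\<dots> \<le> (T * r ^ n i) powr (1 - p) * (lam i * (A * m i))"
    proof (rule mult_mono)
      show "lam i powr (1 - p) \<le> (T * r ^ n i) powr (1 - p)"
        using i p r01 T by (intro powr_mono2') auto
      show "lam i * (om i * lam i powr (p - 1)) \<le> lam i * (A * m i)"
        using lam[OF i(1)] A(2)[OF i(1)] by (intro mult_left_mono) auto
    qed (use lam[OF i(1)] om[OF i(1)] in auto)
    also have "\<dots> = T powr (1 - p) * A * (b ^ n i * (lam i * m i))"
      using T r01 by (simp add: powr_mult rb)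
    finally show ?thesis .
  qed
  have "(\<Sum>i\<in>I. lam i * om i) = (\<Sum>i\<in>S. lam i * om i) + (\<Sum>i\<in>I - S. lam i * om i)"
    using sum.subset_diff[OF Sf(2) I(1)] by (simp add: add.commute)
  also have "(\<Sum>i\<in>I - S. lam i * om i) \<le> (\<Sum>i\<in>I - S. T powr (1 - p) * A * (b ^ n i * (lam i * m i)))"
    by (rule sum_mono) (rule high)
  also have "\<dots> \<le> (\<Sum>i\<in>I. T powr (1 - p) * A * (b ^ n i * (lam i * m i)))"
    using I A m b lam by (intro sum_mono2 mult_nonneg_nonneg) (auto simp: less_imp_le)
  also have "\<dots> = T powr (1 - p) * A * (\<Sum>i\<in>I. b ^ n i * (lam i * m i))"
    by (simp add: sum_distrib_left)
  also have "\<dots> \<le> T powr (1 - p) * A * (4 * (\<Sum>i\<in>I. lam i * m i))"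
    using exp_sum A by (intro mult_left_mono) auto
  finally show ?thesis using low unfolding r_def by (simp add: mult_ac)
qed

section \<open>Stopping cubes and their embedding theorem\<close>

text \<open>
  With \<open>L\<close> the dyadic level of an average, these are the stopping (principal) cubes: the level
  along a chain of cubes, read from the largest cube down, sets a new record there. Comparing
  integer levels rather than the averages themselves makes the choice explicit and still makes the
  averages grow geometrically along chains of records.
\<close>
definition records :: "'a set set \<Rightarrow> ('a set \<Rightarrow> int) \<Rightarrow> 'a set set" where
  "records \<Q> L = {Q \<in> \<Q>. \<forall>P\<in>\<Q>. Q \<subset> P \<longrightarrow> L P < L Q}"

definition stopping_cube :: "'a set set \<Rightarrow> ('a set \<Rightarrow> int) \<Rightarrow> 'a set \<Rightarrow> 'a set" where
  "stopping_cube \<Q> L Q = \<Inter>{F \<in> records \<Q> L. Q \<subseteq> F}"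

lemma stopping_cube_le: "F \<in> records \<Q> L \<Longrightarrow> Q \<subseteq> F \<Longrightarrow> stopping_cube \<Q> L Q \<subseteq> F"
  unfolding stopping_cube_def by blast

lemma subset_stopping_cube: "Q \<subseteq> stopping_cube \<Q> L Q"
  unfolding stopping_cube_def by blast

text \<open>
  Among the cubes containing \<open>Q\<close>, the largest one of maximal level is a record and contains the
  stopping cube of \<open>Q\<close>; hence the level of the stopping cube is at least that of \<open>Q\<close>.
\<close>
lemma stopping_cube:
  assumes "finite \<Q>" "laminar \<Q>" "Q \<in> \<Q>" "Q \<noteq> {}"
  shows "stopping_cube \<Q> L Q \<in> records \<Q> L" "L Q \<le> L (stopping_cube \<Q> L Q)"
proof -
  let ?C = "{P \<in> \<Q>. Q \<subseteq> P}" and ?S = "stopping_cube \<Q> L Q"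
  define k where "k = Max (L ` ?C)"
  have fin: "finite (L ` ?C)" "L ` ?C \<noteq> {}" using assms by auto
  have k: "k \<in> L ` ?C" "\<And>P. P \<in> ?C \<Longrightarrow> L P \<le> k"
    using Max_in[OF fin] fin(1) by (auto simp: k_def)
  obtain R where R: "R \<in> ?C" "L R = k" "\<And>P. P \<in> ?C \<Longrightarrow> L P = k \<Longrightarrow> R \<subseteq> P \<Longrightarrow> R = P"
  proof -
    have "finite {P \<in> ?C. L P = k}" "{P \<in> ?C. L P = k} \<noteq> {}" using k(1) assms(1) by auto
    from finite_has_maximal[OF this] show thesis using that by blast
  qed
  have Rrec: "R \<in> records \<Q> L"
    unfolding records_def
  proof (intro CollectI conjI ballI impI)
    fix P assume P: "P \<in> \<Q>" "R \<subset> P"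
    then have "P \<in> ?C" using R(1) by auto
    then have "L P \<le> k" "L P \<noteq> k" using k(2) R(3)[of P] P(2) by auto
    then show "L P < L R" using R(2) by simp
  qed (use R in auto)
  let ?F = "{F \<in> records \<Q> L. Q \<subseteq> F}"
  have F: "finite ?F" "R \<in> ?F" using assms(1) Rrec R(1) by (auto simp: records_def)
  obtain G where G: "G \<in> ?F" "\<And>P. P \<in> ?F \<Longrightarrow> P \<subseteq> G \<Longrightarrow> G = P"
    using finite_has_minimal[of ?F] F by auto
  have "G \<subseteq> P" if "P \<in> ?F" for P
  proof -
    have "G \<subseteq> P \<or> P \<subseteq> G"
      using laminar_chain[OF assms(2) _ _ assms(4)] G(1) that by (auto simp: records_def)
    then show ?thesis using G(2)[OF that] by auto
  qed
  then have SG: "?S = G" using G(1) unfolding stopping_cube_def by blast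
  then show *: "?S \<in> records \<Q> L" using G(1) by simp
  have "?S \<subseteq> R" using stopping_cube_le[OF Rrec] R(1) by auto
  then have "k \<le> L ?S"
    using * R(1,2) by (cases "?S = R") (auto simp: records_def)
  then show "L Q \<le> L ?S" using k(2)[of Q] assms(3) by auto
qed

text \<open>
  The Carleson embedding theorem for stopping cubes, without a maximal function. At least half of
  the average of \<open>f\<close> over \<open>F\<close> comes from the set where \<open>a F < 2 * f\<close>. At a point \<open>x\<close> the cubes that
  contribute form a chain with distinct levels, all averages being below \<open>2 * f x\<close>, so the sum
  of \<open>a F powr (p - 1)\<close> over them is a multiple of \<open>f x powr (p - 1)\<close>.
\<close>
lemma records_embedding:
  fixes N :: "'b measure" and f :: "'b \<Rightarrow> real" and a :: "'b set \<Rightarrow> real"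
  assumes fin: "finite \<F>" and lamin: "laminar \<F>"
    and meas: "\<And>F. F \<in> \<F> \<Longrightarrow> F \<in> sets N" "\<And>F. F \<in> \<F> \<Longrightarrow> emeasure N F < \<infinity>"
      "\<And>F. F \<in> \<F> \<Longrightarrow> 0 < measure N F"
    and rec: "\<And>F G. F \<in> \<F> \<Longrightarrow> G \<in> \<F> \<Longrightarrow> F \<subset> G \<Longrightarrow> level (a G) < level (a F)"
    and a: "\<And>F. F \<in> \<F> \<Longrightarrow> a F = (LINT x:F|N. f x) / measure N F"
    and a0: "\<And>F. F \<in> \<F> \<Longrightarrow> 0 < a F"
    and f: "f \<in> borel_measurable N" "\<And>x. 0 \<le> f x" "integrable N (\<lambda>x. f x powr p)"
    and p: "1 < p"
  shows "(\<Sum>F\<in>\<F>. a F powr p * measure N F)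
    \<le> 2 * (2 powr (p - 1)) ^ 3 / (2 powr (p - 1) - 1) * (LINT x|N. f x powr p)"
proof -
  define b where "b = 2 powr (p - 1)"
  have b: "1 < b" unfolding b_def using p powr_less_mono[of 0 "p - 1" 2] by simp
  define g where "g F x = indicator F x * (if a F < 2 * f x then f x else 0)" for F x
  have [measurable]: "f \<in> borel_measurable N" by fact
  have intf: "set_integrable N F f" if "F \<in> \<F>" for F
    using a[OF that] a0[OF that] not_integrable_integral_eq[of N "\<lambda>x. indicator F x *\<^sub>R f x"]
    unfolding set_integrable_def set_lebesgue_integral_def by fastforce
  have intg: "integrable N (g F)" if F: "F \<in> \<F>" for F
  proof (rule Bochner_Integration.integrable_bound)
    show "integrable N (\<lambda>x. indicator F x *\<^sub>R f x)" using intf[OF F] by (simp add: set_integrable_def)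
    have [measurable]: "F \<in> sets N" using meas F by simp
    show "g F \<in> borel_measurable N" unfolding g_def by measurable
    show "AE x in N. norm (g F x) \<le> norm (indicator F x *\<^sub>R f x)"
      using f(2) by (auto simp: g_def indicator_def)
  qed
  have key: "a F powr p * measure N F \<le> 2 * a F powr (p - 1) * (LINT x|N. g F x)" if F: "F \<in> \<F>" for F
  proof -
    have iF: "integrable N (\<lambda>x. a F / 2 * indicator F x)"
      using meas[OF F] by (intro integrable_mult_right) simp
    have "a F * measure N F = (LINT x|N. indicator F x *\<^sub>R f x)"
      using a[OF F] meas(3)[OF F] by (simp add: set_lebesgue_integral_def)
    also have "\<dots> \<le> (LINT x|N. g F x + a F / 2 * indicator F x)"
    proof (rule integral_mono)
      show "integrable N (\<lambda>x. g F x + a F / 2 * indicator F x)"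
        using intg[OF F] iF by (rule Bochner_Integration.integrable_add)
    qed (use intf[OF F] a0[OF F] in \<open>auto simp: g_def indicator_def set_integrable_def\<close>)
    also have "\<dots> = (LINT x|N. g F x) + a F / 2 * measure N F"
      using intg[OF F] iF meas[OF F] by simp
    finally have "a F * measure N F \<le> 2 * (LINT x|N. g F x)" by simp
    then have "a F powr (p - 1) * (a F * measure N F) \<le> a F powr (p - 1) * (2 * (LINT x|N. g F x))"
      by (rule mult_left_mono) simp
    moreover have "a F powr p = a F powr (p - 1) * a F"
      using a0[OF F] by (simp add: powr_diff)
    ultimately show ?thesis by (simp add: mult_ac)
  qed
  have ptw: "(\<Sum>F\<in>\<F>. 2 * a F powr (p - 1) * g F x) \<le> 2 * b ^ 3 / (b - 1) * f x powr p" for x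
  proof -
    let ?S = "{F \<in> \<F>. x \<in> F \<and> a F < 2 * f x}"
    have fS: "finite ?S" using fin by auto
    have inj: "inj_on (\<lambda>F. level (a F)) ?S"
    proof (rule inj_onI)
      fix F G assume FG: "F \<in> ?S" "G \<in> ?S" "level (a F) = level (a G)"
      have "F \<subseteq> G \<or> G \<subseteq> F" using lamin FG unfolding laminar_def by blast
      then show "F = G" using rec[of F G] rec[of G F] FG by auto
    qed
    have "(\<Sum>F\<in>\<F>. 2 * a F powr (p - 1) * g F x) = (\<Sum>F\<in>?S. 2 * a F powr (p - 1) * f x)"
      using fin by (intro sum.mono_neutral_cong_right) (auto simp: g_def indicator_def)
    also have "\<dots> \<le> (\<Sum>F\<in>?S. 2 * (b * b powr real_of_int (level (a F))) * f x)"
    proof (intro sum_mono mult_right_mono mult_left_mono)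
      fix F assume "F \<in> ?S"
      then have "0 < a F" using a0 by auto
      then have "a F powr (p - 1) \<le> (2 * 2 powr real_of_int (level (a F))) powr (p - 1)"
        using level_bounds(2)[of "a F"] p by (intro powr_mono2) auto
      then show "a F powr (p - 1) \<le> b * b powr real_of_int (level (a F))"
        by (simp add: b_def powr_mult powr_powr mult.commute)
    qed (use f in auto)
    also have "\<dots> = 2 * b * f x * (\<Sum>k\<in>(\<lambda>F. level (a F)) ` ?S. b powr real_of_int k)"
      by (subst sum.reindex[OF inj]) (simp add: sum_distrib_left mult_ac)
    also have "\<dots> \<le> 2 * b * f x * (b / (b - 1) * (2 * f x) powr (p - 1))"
    proof (intro mult_left_mono sum_int_powers_le)
      fix k assume "k \<in> (\<lambda>F. level (a F)) ` ?S"
      then obtain F where F: "F \<in> ?S" "k = level (a F)" by auto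
      then have "0 < a F" using a0 by auto
      then have "(2 powr real_of_int k) powr (p - 1) \<le> (2 * f x) powr (p - 1)"
        using level_bounds(1)[of "a F"] p F by (intro powr_mono2) auto
      then show "b powr real_of_int k \<le> (2 * f x) powr (p - 1)"
        by (simp add: b_def powr_powr mult.commute)
    qed (use b f fS in auto)
    also have "\<dots> = 2 * b ^ 3 / (b - 1) * f x powr p"
    proof (cases "f x = 0")
      case False
      have "(2 * f x) powr (p - 1) = b * (f x powr p / f x)"
        using f(2)[of x] False by (simp add: powr_mult powr_diff[of "f x"] b_def)
      then show ?thesis using False by (simp add: power3_eq_cube)
    qed simp
    finally show ?thesis .
  qed
  have "(\<Sum>F\<in>\<F>. a F powr p * measure N F) \<le> (\<Sum>F\<in>\<F>. 2 * a F powr (p - 1) * (LINT x|N. g F x))"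
    by (rule sum_mono) (rule key)
  also have "\<dots> = (LINT x|N. (\<Sum>F\<in>\<F>. 2 * a F powr (p - 1) * g F x))"
    using intg by (simp add: Bochner_Integration.integral_sum)
  also have "\<dots> \<le> (LINT x|N. 2 * b ^ 3 / (b - 1) * f x powr p)"
    using intg f(3) by (intro integral_mono ptw Bochner_Integration.integrable_sum) auto
  also have "\<dots> = 2 * b ^ 3 / (b - 1) * (LINT x|N. f x powr p)" by simp
  finally show ?thesis by (simp add: b_def)
qed

section \<open>The estimate when one stopping cube determines the other\<close>

text \<open>Bounds with a free parameter \<open>s\<close> stand in for Hoelder's inequality; this recovers the product of norms.\<close>
lemma optimize_split:
  fixes U V X c p p' :: real
  assumes "1 < p" "1 / p + 1 / p' = 1" "0 < U" "0 < V"
    and X: "\<And>s. 0 < s \<Longrightarrow> X \<le> c * (s * V + s powr (1 - p) * U)"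
  shows "X \<le> 2 * c * (U powr (1 / p) * V powr (1 / p'))"
proof -
  define s where "s = (U / V) powr (1 / p)"
  have s: "0 < s" using assms by (simp add: s_def)
  have p': "1 / p' = 1 - 1 / p" using assms by linarith
  have e: "1 / p * (1 - p) = 1 / p - 1" using assms(1) by (simp add: field_simps)
  have "s * V = U powr (1 / p) * V powr (1 / p')"
    using assms(3,4) unfolding p' by (simp add: s_def powr_divide powr_diff)
  moreover have "s powr (1 - p) * U = U powr (1 / p) * V powr (1 / p')"
    using assms(3,4) unfolding p' s_def powr_powr e by (simp add: powr_divide powr_diff)
  ultimately show ?thesis using X[OF s] by (simp add: algebra_simps)
qed

lemma conjugate_exponent:
  fixes p p' :: real
  assumes "1 < p" "1 / p + 1 / p' = 1"
  shows "1 < p'" "(p - 1) * (p' - 1) = 1" "p * (p' - 1) = p'"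
proof -
  have "1 / p' = (p - 1) / p" using assms by (simp add: field_simps)
  then have "1 / (1 / p') = 1 / ((p - 1) / p)" by (rule arg_cong)
  then have p': "p' = p / (p - 1)" by simp
  show "1 < p'" "(p - 1) * (p' - 1) = 1" "p * (p' - 1) = p'"
    using assms(1) by (simp_all add: p' field_simps)
qed

lemma sum_measure_disjoint_le:
  assumes "finite J" "\<And>i. i \<in> J \<Longrightarrow> P i \<in> sets N" "\<And>i. i \<in> J \<Longrightarrow> P i \<subseteq> X"
    and "X \<in> sets N" "emeasure N X < \<infinity>" "disjoint_family_on P J"
  shows "(\<Sum>i\<in>J. measure N (P i)) \<le> measure N X"
proof -
  have "emeasure N (P i) \<noteq> \<infinity>" if "i \<in> J" for i
    using emeasure_mono[OF assms(3)[OF that] assms(4)] assms(5) by auto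
  then have "(\<Sum>i\<in>J. measure N (P i)) = measure N (\<Union>i\<in>J. P i)"
    using assms by (intro measure_finite_Union[symmetric]) auto
  also have "\<dots> \<le> measure N X"
    using assms by (intro measure_mono_fmeasurable) (auto simp: fmeasurable_def)
  finally show ?thesis .
qed

text \<open>
  Each group of indices with the same \<open>G i\<close> also has the same \<open>F i\<close>, so the averages \<open>\<alpha>\<close> and \<open>\<beta>\<close> are
  constants on it and the layered sum bound applies inside \<open>G i\<close>.
\<close>
lemma one_sided_sum_bound:
  fixes P F G :: "'i \<Rightarrow> 'a set" and \<alpha> \<beta> :: "'a set \<Rightarrow> real" and sg m :: "'i \<Rightarrow> real"
  assumes I: "finite I" "inj_on P I" "laminar (P ` I)" "\<And>i. i \<in> I \<Longrightarrow> P i \<noteq> {}"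
    and m: "\<And>i. i \<in> I \<Longrightarrow> 0 < m i"
    and K: "0 < K" "\<And>j. j \<in> I \<Longrightarrow> (\<Sum>i\<in>{i \<in> I. P i \<subseteq> P j}. m i) \<le> K * m j"
    and sg: "\<And>i. i \<in> I \<Longrightarrow> 0 < sg i"
    and A: "0 \<le> A" "\<And>i. i \<in> I \<Longrightarrow> measure N (P i) * sg i powr (p - 1) \<le> A * m i powr p"
    and PG: "\<And>i. i \<in> I \<Longrightarrow> P i \<subseteq> G i" "\<And>i. i \<in> I \<Longrightarrow> P i \<in> sets N"
    and G: "\<And>i. i \<in> I \<Longrightarrow> G i \<in> sets N" "\<And>i. i \<in> I \<Longrightarrow> emeasure N (G i) < \<infinity>"
    and F: "\<And>i j. i \<in> I \<Longrightarrow> j \<in> I \<Longrightarrow> G i = G j \<Longrightarrow> F i = F j"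
    and pos: "\<And>i. i \<in> I \<Longrightarrow> 0 < \<alpha> (F i)" "\<And>i. i \<in> I \<Longrightarrow> 0 < \<beta> (G i)"
    and p: "1 < p" "1 / p + 1 / p' = 1" and s: "0 < s"
  shows "(\<Sum>i\<in>I. \<alpha> (F i) * \<beta> (G i) * (sg i * measure N (P i) / m i))
    \<le> 4 / (1 - decay_ratio p K) * s * (\<Sum>X\<in>G ` I. \<beta> X powr p' * measure N X)
       + 4 * s powr (1 - p) * A * (\<Sum>i\<in>I. \<alpha> (F i) powr p * sg i)"
proof -
  let ?r = "decay_ratio p K"
  let ?t = "\<lambda>i. \<alpha> (F i) * \<beta> (G i) * (sg i * measure N (P i) / m i)"
  let ?I = "\<lambda>X. {i \<in> I. G i = X}"
  note cp = conjugate_exponent[OF p]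
  have group: "(\<Sum>i\<in>?I X. ?t i) \<le> 4 / (1 - ?r) * s * (\<beta> X powr p' * measure N X)
      + 4 * s powr (1 - p) * A * (\<Sum>i\<in>?I X. \<alpha> (F i) powr p * sg i)" if X: "X \<in> G ` I" for X
  proof -
    obtain j where j: "j \<in> I" "G j = X" using X by auto
    define a where "a = \<alpha> (F j)"
    define b where "b = \<beta> X"
    \<comment> \<open>This \<open>T\<close> turns \<open>a * b * T\<close> into \<open>s * b powr p'\<close> and \<open>a * b * T powr (1 - p)\<close> into \<open>s powr (1 - p) * a powr p\<close>.\<close>
    define T where "T = s * b powr (p' - 1) / a"
    have ab: "0 < a" "0 < b" using pos j by (auto simp: a_def b_def)
    have T: "0 < T" using s ab by (simp add: T_def)
    have Fa: "\<alpha> (F i) = a" if "i \<in> ?I X" for i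
      using F[of i j] that j by (simp add: a_def)
    have sub: "?I X \<subseteq> I" by auto
    have "(\<Sum>i\<in>?I X. sg i / m i * measure N (P i))
        \<le> 4 / (1 - ?r) * T * measure N X + 4 * T powr (1 - p) * A * (\<Sum>i\<in>?I X. sg i / m i * m i)"
    proof (rule layered_sum_bound[where P = P and K = K])
      show "inj_on P (?I X)" by (rule inj_on_subset[OF I(2) sub])
      show "laminar (P ` ?I X)" by (rule laminar_subset[OF I(3) image_mono[OF sub]])
      fix i assume i: "i \<in> ?I X"
      show "0 < sg i / m i" using i sg m by auto
      have "(\<Sum>k\<in>{k \<in> ?I X. P k \<subseteq> P i}. m k) \<le> (\<Sum>k\<in>{k \<in> I. P k \<subseteq> P i}. m k)"
        by (rule sum_mono2) (use I m in \<open>auto simp: less_imp_le\<close>)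
      then show "(\<Sum>k\<in>{k \<in> ?I X. P k \<subseteq> P i}. m k) \<le> K * m i" using K(2)[of i] i by auto
      have mi: "0 < m i" using m i by auto
      have "measure N (P i) * (sg i / m i) powr (p - 1)
          = measure N (P i) * sg i powr (p - 1) / m i powr (p - 1)"
        using mi sg[of i] i by (simp add: powr_divide)
      also have "\<dots> \<le> A * m i powr p / m i powr (p - 1)"
        using A(2)[of i] i by (intro divide_right_mono) auto
      also have "\<dots> = A * m i" using mi by (simp add: powr_diff)
      finally show "measure N (P i) * (sg i / m i) powr (p - 1) \<le> A * m i" .
    next
      fix J assume J: "J \<subseteq> ?I X" "disjoint_family_on P J"
      show "(\<Sum>i\<in>J. measure N (P i)) \<le> measure N X"
      proof (rule sum_measure_disjoint_le[OF _ _ _ _ _ J(2)])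
        show "finite J" using J(1) I(1) finite_subset by fastforce
        show "\<And>i. i \<in> J \<Longrightarrow> P i \<subseteq> X" using J(1) PG(1) by blast
      qed (use J(1) PG(2) G[OF j(1)] j(2) in auto)
    qed (use I m K(1) A(1) p T in \<open>auto simp: less_imp_le\<close>)
    note layered = this
    let ?S = "\<Sum>i\<in>?I X. sg i / m i * m i"
    have abT: "a * b * T = s * b powr p'"
      using ab by (simp add: T_def powr_diff)
    have abT': "a * b * T powr (1 - p) = s powr (1 - p) * a powr p"
    proof -
      have e: "(p' - 1) * (1 - p) = - 1" using cp(2) by (simp add: algebra_simps)
      have "T powr (1 - p) = s powr (1 - p) * b powr (- 1) / a powr (1 - p)"
        using ab s by (simp add: T_def powr_divide powr_mult powr_powr e)
      then show ?thesis using ab by (simp add: powr_diff powr_minus field_simps)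
    qed
    have aS: "a powr p * ?S = (\<Sum>i\<in>?I X. \<alpha> (F i) powr p * sg i)"
      unfolding sum_distrib_left using Fa m by (intro sum.cong) (auto simp: less_imp_neq[symmetric])
    have "(\<Sum>i\<in>?I X. ?t i) = a * b * (\<Sum>i\<in>?I X. sg i / m i * measure N (P i))"
      unfolding sum_distrib_left by (rule sum.cong) (use Fa in \<open>auto simp: b_def\<close>)
    also have "\<dots> \<le> a * b * (4 / (1 - ?r) * T * measure N X + 4 * T powr (1 - p) * A * ?S)"
      using ab by (intro mult_left_mono layered) auto
    also have "\<dots> = 4 / (1 - ?r) * (a * b * T) * measure N X + 4 * (a * b * T powr (1 - p)) * A * ?S"
      by (simp only: distrib_left mult_ac)
    also have "\<dots> = 4 / (1 - ?r) * s * (b powr p' * measure N X) + 4 * s powr (1 - p) * A * (a powr p * ?S)"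
      unfolding abT abT' by (simp only: mult_ac)
    finally show ?thesis unfolding aS b_def .
  qed
  have "(\<Sum>i\<in>I. ?t i) = (\<Sum>X\<in>G ` I. \<Sum>i\<in>?I X. ?t i)"
    by (rule sum.image_gen[OF I(1)])
  also have "\<dots> \<le> (\<Sum>X\<in>G ` I. 4 / (1 - ?r) * s * (\<beta> X powr p' * measure N X)
      + 4 * s powr (1 - p) * A * (\<Sum>i\<in>?I X. \<alpha> (F i) powr p * sg i))"
    by (rule sum_mono) (rule group)
  also have "\<dots> = 4 / (1 - ?r) * s * (\<Sum>X\<in>G ` I. \<beta> X powr p' * measure N X)
      + 4 * s powr (1 - p) * A * (\<Sum>X\<in>G ` I. \<Sum>i\<in>?I X. \<alpha> (F i) powr p * sg i)"
    by (simp add: sum.distrib sum_distrib_left)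
  also have "(\<Sum>X\<in>G ` I. \<Sum>i\<in>?I X. \<alpha> (F i) powr p * sg i) = (\<Sum>i\<in>I. \<alpha> (F i) powr p * sg i)"
    by (rule sum.image_gen[OF I(1), symmetric])
  finally show ?thesis .
qed

section \<open>The form over a separated matching\<close>

definition average :: "'a measure \<Rightarrow> ('a \<Rightarrow> real) \<Rightarrow> 'a set \<Rightarrow> real" where
  "average N f X = (LINT x:X|N. f x) / measure N X"

definition embedding_const :: "real \<Rightarrow> real" where
  "embedding_const p = 2 * (2 powr (p - 1)) ^ 3 / (2 powr (p - 1) - 1)"

definition half_const :: "real \<Rightarrow> real \<Rightarrow> real \<Rightarrow> real" where
  "half_const p p' K = 64 / (1 - decay_ratio p (2 * K + 1)) * (embedding_const p + embedding_const p')"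

lemma embedding_const_pos: "1 < p \<Longrightarrow> 0 < embedding_const p"
  using powr_less_mono[of 0 "p - 1" 2] by (simp add: embedding_const_def)

lemma half_const_pos:
  assumes "1 < p" "1 < p'" "0 < K"
  shows "0 < half_const p p' K"
proof -
  have "decay_ratio p (2 * K + 1) < 1" by (rule decay_ratio_less_1) (use assms in auto)
  then have "0 < 64 / (1 - decay_ratio p (2 * K + 1))" by simp
  then show ?thesis unfolding half_const_def
    by (intro mult_pos_pos add_pos_pos embedding_const_pos assms) auto
qed

lemma records_less: "X \<in> records \<Q> L \<Longrightarrow> Y \<in> \<Q> \<Longrightarrow> X \<subset> Y \<Longrightarrow> L Y < L X"
  unfolding records_def by blast

text \<open>
  One colour class, with \<open>N1\<close> and \<open>N2\<close> playing the roles of \<open>\<sigma> d\<mu>\<close> and \<open>\<omega> d\<mu>\<close>. The set \<open>R i\<close> stands for the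
  common ancestor of \<open>Q i\<close> and \<open>P i\<close>. All hypotheses are invariant under exchanging the two sides, which
  is why only one half of the estimate has to be proved.
\<close>
locale separated_pairs =
  fixes M N1 N2 :: "'a measure" and I :: "'i set" and Q P R :: "'i \<Rightarrow> 'a set"
    and f g :: "'a \<Rightarrow> real" and p p' K A U1 U2 :: real
  assumes I: "finite I" "inj_on Q I" "inj_on P I" "laminar (Q ` I \<union> P ` I)"
    and setsN: "sets N1 = sets M" "sets N2 = sets M"
    and QM: "\<And>i. i \<in> I \<Longrightarrow> Q i \<in> sets M" and PM: "\<And>i. i \<in> I \<Longrightarrow> P i \<in> sets M"
    and M_pos: "\<And>i. i \<in> I \<Longrightarrow> 0 < measure M (Q i)" "\<And>i. i \<in> I \<Longrightarrow> 0 < measure M (P i)"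
    and N1_pos: "\<And>i. i \<in> I \<Longrightarrow> 0 < measure N1 (Q i)"
    and N2_pos: "\<And>i. i \<in> I \<Longrightarrow> 0 < measure N2 (P i)"
    and R: "\<And>i. i \<in> I \<Longrightarrow> Q i \<subseteq> R i" "\<And>i. i \<in> I \<Longrightarrow> P i \<subseteq> R i"
    and sep: "\<And>i j. i \<in> I \<Longrightarrow> j \<in> I \<Longrightarrow> Q i \<subset> Q j \<Longrightarrow> R i \<subseteq> Q j"
      "\<And>i j. i \<in> I \<Longrightarrow> j \<in> I \<Longrightarrow> P i \<subset> P j \<Longrightarrow> R i \<subseteq> P j"
    and K: "0 < K"
    and packing_M: "\<And>X. X \<in> Q ` I \<union> P ` I \<Longrightarrow> (\<Sum>i\<in>{i \<in> I. Q i \<subseteq> X}. measure M (Q i)) \<le> K * measure M X"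
      "\<And>X. X \<in> Q ` I \<union> P ` I \<Longrightarrow> (\<Sum>i\<in>{i \<in> I. P i \<subseteq> X}. measure M (P i)) \<le> K * measure M X"
    and packing_N1: "\<And>X. X \<in> Q ` I \<Longrightarrow> (\<Sum>i\<in>{i \<in> I. Q i \<subseteq> X}. measure N1 (Q i)) \<le> U1 * measure N1 X"
    and packing_N2: "\<And>X. X \<in> P ` I \<Longrightarrow> (\<Sum>i\<in>{i \<in> I. P i \<subseteq> X}. measure N2 (P i)) \<le> U2 * measure N2 X"
    and U: "0 < U1" "0 < U2"
    and A: "0 < A" "\<And>i. i \<in> I \<Longrightarrow> measure N2 (P i) * measure N1 (Q i) powr (p - 1)
        \<le> A * max (measure M (Q i)) (measure M (P i)) powr p"
    and f: "f \<in> borel_measurable N1" "\<And>x. 0 \<le> f x" "integrable N1 (\<lambda>x. f x powr p)"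
    and g: "g \<in> borel_measurable N2" "\<And>x. 0 \<le> g x" "integrable N2 (\<lambda>x. g x powr p')"
    and f_pos: "\<And>i. i \<in> I \<Longrightarrow> 0 < average N1 f (Q i)"
    and g_pos: "\<And>i. i \<in> I \<Longrightarrow> 0 < average N2 g (P i)"
    and p: "1 < p" "1 / p + 1 / p' = 1"
begin

definition m :: "'i \<Rightarrow> real" where
  "m i = max (measure M (Q i)) (measure M (P i))"

definition stopQ :: "'a set \<Rightarrow> 'a set" where
  "stopQ = stopping_cube (Q ` I) (\<lambda>X. level (average N1 f X))"

definition stopP :: "'a set \<Rightarrow> 'a set" where
  "stopP = stopping_cube (P ` I) (\<lambda>X. level (average N2 g X))"

text \<open>
  The only hypothesis that is not visibly symmetric is the \<open>A\<^sub>p\<close> condition; raising it to the power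
  \<open>p' - 1 = 1 / (p - 1)\<close> gives its dual form.
\<close>
lemma swapped: "separated_pairs M N2 N1 I P Q R g f p' p K (A powr (p' - 1)) U2 U1"
proof -
  note cp = conjugate_exponent[OF p]
  have A': "measure N1 (Q i) * measure N2 (P i) powr (p' - 1)
      \<le> A powr (p' - 1) * max (measure M (P i)) (measure M (Q i)) powr p'" if i: "i \<in> I" for i
  proof -
    have "measure N1 (Q i) * measure N2 (P i) powr (p' - 1)
        = (measure N2 (P i) * measure N1 (Q i) powr (p - 1)) powr (p' - 1)"
      using N1_pos[OF i] N2_pos[OF i] cp(2) by (simp add: powr_mult powr_powr mult.commute)
    also have "\<dots> \<le> (A * max (measure M (Q i)) (measure M (P i)) powr p) powr (p' - 1)"
      using A(2)[OF i] cp(1) by (intro powr_mono2) auto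
    also have "\<dots> = A powr (p' - 1) * max (measure M (P i)) (measure M (Q i)) powr p'"
      using A(1) M_pos[OF i] cp(3) by (simp add: powr_mult powr_powr max.commute)
    finally show ?thesis .
  qed
  show ?thesis
    by unfold_locales
      (use I setsN QM PM M_pos N1_pos N2_pos R sep K packing_M packing_N1 packing_N2 U A A' f g f_pos
        g_pos p cp in \<open>auto simp: Un_commute add.commute\<close>)
qed

lemma nonempty: "i \<in> I \<Longrightarrow> Q i \<noteq> {}" "i \<in> I \<Longrightarrow> P i \<noteq> {}"
  using M_pos by fastforce+

lemma laminar_images: "laminar (Q ` I)" "laminar (P ` I)"
  using I(4) laminar_subset by blast+

lemma stopQ:
  assumes i: "i \<in> I"
  shows "stopQ (Q i) \<in> records (Q ` I) (\<lambda>X. level (average N1 f X))" "Q i \<subseteq> stopQ (Q i)"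
    "average N1 f (Q i) \<le> 2 * average N1 f (stopQ (Q i))" "0 < average N1 f (stopQ (Q i))"
    "stopQ (Q i) \<in> Q ` I"
proof -
  let ?a = "average N1 f" and ?S = "stopQ (Q i)"
  show rec: "?S \<in> records (Q ` I) (\<lambda>X. level (?a X))"
    unfolding stopQ_def using i I(1) laminar_images(1) nonempty(1) by (intro stopping_cube) auto
  show "Q i \<subseteq> ?S" unfolding stopQ_def by (rule subset_stopping_cube)
  have le: "level (?a (Q i)) \<le> level (?a ?S)"
    unfolding stopQ_def by (rule stopping_cube(2)) (use i I(1) laminar_images(1) nonempty(1) in auto)
  show QI: "?S \<in> Q ` I" using rec by (auto simp: records_def)
  then show pos: "0 < ?a ?S" using f_pos by auto
  have "?a (Q i) \<le> 2 * 2 powr real_of_int (level (?a (Q i)))"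
    using level_bounds(2) f_pos[OF i] by blast
  also have "\<dots> \<le> 2 * 2 powr real_of_int (level (?a ?S))"
    using le by simp
  also have "\<dots> \<le> 2 * ?a ?S" using level_bounds(1)[OF pos] by simp
  finally show "?a (Q i) \<le> 2 * ?a ?S" .
qed

lemma stopQ_le: "i \<in> I \<Longrightarrow> j \<in> I \<Longrightarrow> Q i \<subseteq> stopQ (Q j) \<Longrightarrow> stopQ (Q i) \<subseteq> stopQ (Q j)"
  using stopping_cube_le[OF stopQ(1)] unfolding stopQ_def by blast

lemma N1_finite: "i \<in> I \<Longrightarrow> emeasure N1 (Q i) < \<infinity>"
  using N1_pos[of i] by (auto simp: measure_def less_top enn2real_positive_iff)

lemma embedding_Q:
  assumes "\<F> \<subseteq> records (Q ` I) (\<lambda>X. level (average N1 f X))"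
  shows "(\<Sum>X\<in>\<F>. average N1 f X powr p * measure N1 X) \<le> embedding_const p * (LINT x|N1. f x powr p)"
  unfolding embedding_const_def
proof (rule records_embedding)
  have F: "\<F> \<subseteq> Q ` I" using assms by (auto simp: records_def)
  show "finite \<F>" using F I(1) by (meson finite_imageI finite_subset)
  show "laminar \<F>" by (rule laminar_subset[OF laminar_images(1) F])
  fix X assume "X \<in> \<F>"
  then obtain i where i: "i \<in> I" "X = Q i" using F by auto
  show "X \<in> sets N1" using QM[OF i(1)] i(2) setsN(1) by simp
  show "emeasure N1 X < \<infinity>" unfolding i(2) by (rule N1_finite[OF i(1)])
  show "0 < measure N1 X" unfolding i(2) by (rule N1_pos[OF i(1)])
  show "0 < average N1 f X" unfolding i(2) by (rule f_pos[OF i(1)])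
next
  fix X Y assume XY: "X \<in> \<F>" "Y \<in> \<F>" "X \<subset> Y"
  have "X \<in> records (Q ` I) (\<lambda>X. level (average N1 f X))" "Y \<in> Q ` I"
    using XY(1,2) assms by (auto simp: records_def)
  from records_less[OF this XY(3)]
  show "level (average N1 f Y) < level (average N1 f X)" .
qed (use f p in \<open>auto simp: average_def\<close>)

lemma f_norm_pos:
  assumes "I \<noteq> {}"
  shows "0 < (LINT x|N1. f x powr p)"
proof -
  obtain i where i: "i \<in> I" using assms by auto
  have "0 < average N1 f (stopQ (Q i)) powr p * measure N1 (stopQ (Q i))"
    using stopQ(4,5)[OF i] N1_pos by (auto simp: image_iff)
  also have "\<dots> \<le> embedding_const p * (LINT x|N1. f x powr p)"
    using embedding_Q[of "{stopQ (Q i)}"] stopQ(1)[OF i] by simp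
  finally show ?thesis using embedding_const_pos[OF p(1)] by (simp add: zero_less_mult_iff)
qed

text \<open>
  If \<open>P i\<close> lies strictly inside \<open>P j\<close>, separation puts \<open>Q i\<close> inside \<open>P j\<close> too, so both measures in
  \<open>m i\<close> are packed by sparseness in terms of \<open>\<mu> (P j)\<close>. Without separation \<open>Q i\<close> could be a much heavier
  neighbour of \<open>P j\<close>, and no packing of \<open>m\<close> would hold for a general \<open>\<mu>\<close>.
\<close>
lemma packing_m:
  assumes j: "j \<in> I"
  shows "(\<Sum>i\<in>{i \<in> I. P i \<subseteq> P j}. m i) \<le> (2 * K + 1) * m j"
proof -
  let ?S = "{i \<in> I. P i \<subset> P j}"
  have eq: "{i \<in> I. P i \<subseteq> P j} = insert j ?S"
    using j I(3) by (auto dest: inj_onD)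
  have sub: "?S \<subseteq> {i \<in> I. Q i \<subseteq> P j}" "?S \<subseteq> {i \<in> I. P i \<subseteq> P j}"
    using sep(2)[OF _ j] R(1) by blast+
  have "(\<Sum>i\<in>?S. m i) \<le> (\<Sum>i\<in>?S. measure M (Q i)) + (\<Sum>i\<in>?S. measure M (P i))"
    unfolding sum.distrib[symmetric] by (rule sum_mono) (auto simp: m_def)
  also have "\<dots> \<le> (\<Sum>i\<in>{i \<in> I. Q i \<subseteq> P j}. measure M (Q i)) + (\<Sum>i\<in>{i \<in> I. P i \<subseteq> P j}. measure M (P i))"
    by (intro add_mono sum_mono2 sub) (use I(1) in auto)
  also have "\<dots> \<le> K * measure M (P j) + K * measure M (P j)"
    by (intro add_mono packing_M) (use j in auto)
  also have "\<dots> \<le> 2 * K * m j"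
    using K by (simp add: m_def)
  finally have "(\<Sum>i\<in>?S. m i) \<le> 2 * K * m j" .
  then show ?thesis unfolding eq using I(1) by (simp add: algebra_simps)
qed


lemma stopP:
  assumes i: "i \<in> I"
  shows "stopP (P i) \<in> records (P ` I) (\<lambda>X. level (average N2 g X))" "P i \<subseteq> stopP (P i)"
    "average N2 g (P i) \<le> 2 * average N2 g (stopP (P i))" "0 < average N2 g (stopP (P i))"
    "stopP (P i) \<in> P ` I"
proof -
  interpret sw: separated_pairs M N2 N1 I P Q R g f p' p K "A powr (p' - 1)" U2 U1
    by (rule swapped)
  have "sw.stopQ = stopP" by (intro ext) (simp add: sw.stopQ_def stopP_def)
  then show "stopP (P i) \<in> records (P ` I) (\<lambda>X. level (average N2 g X))" "P i \<subseteq> stopP (P i)"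
    "average N2 g (P i) \<le> 2 * average N2 g (stopP (P i))" "0 < average N2 g (stopP (P i))"
    "stopP (P i) \<in> P ` I"
    using sw.stopQ[OF i] by auto
qed

lemma embedding_P:
  assumes "\<F> \<subseteq> records (P ` I) (\<lambda>X. level (average N2 g X))"
  shows "(\<Sum>X\<in>\<F>. average N2 g X powr p' * measure N2 X) \<le> embedding_const p' * (LINT x|N2. g x powr p')"
  using separated_pairs.embedding_Q[OF swapped assms] .

lemma g_norm_pos: "I \<noteq> {} \<Longrightarrow> 0 < (LINT x|N2. g x powr p')"
  using separated_pairs.f_norm_pos[OF swapped] .

definition summand :: "'i \<Rightarrow> real" where
  "summand i = average N1 f (Q i) * average N2 g (P i) * (measure N1 (Q i) * measure N2 (P i) / m i)"

lemma m_pos: "i \<in> I \<Longrightarrow> 0 < m i"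
  using M_pos(1)[of i] by (simp add: m_def)

lemma summand_nonneg: "i \<in> I \<Longrightarrow> 0 \<le> summand i"
  unfolding summand_def
  using f_pos g_pos m_pos by (intro mult_nonneg_nonneg divide_nonneg_nonneg) (auto simp: less_imp_le)

text \<open>
  The packing constant of \<open>N1\<close> enters because many \<open>Q i\<close> share a stopping cube; on the side of \<open>N2\<close>
  every stopping cube is counted once, so the bound involves \<open>U1\<close> only.
\<close>
lemma coherent_part_split:
  assumes J: "J \<subseteq> I"
    and coh: "\<And>i j. i \<in> J \<Longrightarrow> j \<in> J \<Longrightarrow> stopP (P i) = stopP (P j) \<Longrightarrow> stopQ (Q i) = stopQ (Q j)"
    and s: "0 < s"
  shows "(\<Sum>i\<in>J. summand i) \<le> 16 / (1 - decay_ratio p (2 * K + 1)) * (embedding_const p + embedding_const p')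
    * (s * (LINT x|N2. g x powr p') + s powr (1 - p) * (A * U1 * (LINT x|N1. f x powr p)))"
proof -
  let ?r = "decay_ratio p (2 * K + 1)"
  let ?f = "LINT x|N1. f x powr p" and ?g = "LINT x|N2. g x powr p'"
  let ?a = "\<lambda>i. average N1 f (stopQ (Q i))" and ?b = "\<lambda>i. average N2 g (stopP (P i))"
  let ?w = "\<lambda>i. measure N1 (Q i) * measure N2 (P i) / m i"
  have Jf: "finite J" using J I(1) finite_subset by blast
  have r: "?r < 1" using decay_ratio_less_1[of p "2 * K + 1"] p K by simp
  have r0: "0 \<le> ?r" by (simp add: decay_ratio_def)
  have "(\<Sum>i\<in>J. summand i) \<le> (\<Sum>i\<in>J. 4 * (?a i * ?b i * ?w i))"
  proof (rule sum_mono)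
    fix i assume "i \<in> J"
    then have i: "i \<in> I" using J by auto
    have w: "0 \<le> ?w i" using m_pos[OF i] by simp
    have "summand i \<le> (2 * ?a i) * (2 * ?b i) * ?w i"
      unfolding summand_def
      using stopQ(3)[OF i] stopP(3)[OF i] f_pos[OF i] g_pos[OF i] stopQ(4)[OF i] w
      by (intro mult_right_mono mult_mono) (auto simp: less_imp_le)
    then show "summand i \<le> 4 * (?a i * ?b i * ?w i)" by simp
  qed
  also have "\<dots> = 4 * (\<Sum>i\<in>J. ?a i * ?b i * ?w i)" by (simp add: sum_distrib_left)
  finally have step1: "(\<Sum>i\<in>J. summand i) \<le> 4 * (\<Sum>i\<in>J. ?a i * ?b i * ?w i)" .
  have step2: "(\<Sum>i\<in>J. ?a i * ?b i * ?w i)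
      \<le> 4 / (1 - ?r) * s * (\<Sum>X\<in>(\<lambda>i. stopP (P i)) ` J. average N2 g X powr p' * measure N2 X)
       + 4 * s powr (1 - p) * A * (\<Sum>i\<in>J. ?a i powr p * measure N1 (Q i))"
  proof (rule one_sided_sum_bound[where P = P])
    show "inj_on P J" by (rule inj_on_subset[OF I(3) J])
    show "laminar (P ` J)" by (rule laminar_subset[OF laminar_images(2) image_mono[OF J]])
    show "0 < 2 * K + 1" using K by simp
    fix i assume "i \<in> J"
    then have i: "i \<in> I" using J by auto
    show "P i \<noteq> {}" by (rule nonempty(2)[OF i])
    show "0 < m i" by (rule m_pos[OF i])
    have "(\<Sum>k\<in>{k \<in> J. P k \<subseteq> P i}. m k) \<le> (\<Sum>k\<in>{k \<in> I. P k \<subseteq> P i}. m k)"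
      by (rule sum_mono2) (use I J m_pos in \<open>auto simp: less_imp_le\<close>)
    also have "\<dots> \<le> (2 * K + 1) * m i" by (rule packing_m[OF i])
    finally show "(\<Sum>k\<in>{k \<in> J. P k \<subseteq> P i}. m k) \<le> (2 * K + 1) * m i" .
    show "0 < measure N1 (Q i)" by (rule N1_pos[OF i])
    show "measure N2 (P i) * measure N1 (Q i) powr (p - 1) \<le> A * m i powr p"
      unfolding m_def by (rule A(2)[OF i])
    show "P i \<subseteq> stopP (P i)" by (rule stopP(2)[OF i])
    show "P i \<in> sets N2" using PM[OF i] setsN(2) by simp
    obtain k where k: "k \<in> I" "stopP (P i) = P k" using stopP(5)[OF i] by auto
    show "stopP (P i) \<in> sets N2" unfolding k(2) setsN(2) by (rule PM[OF k(1)])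
    show "emeasure N2 (stopP (P i)) < \<infinity>"
      unfolding k(2) by (rule separated_pairs.N1_finite[OF swapped k(1)])
    show "0 < average N1 f (stopQ (Q i))" by (rule stopQ(4)[OF i])
    show "0 < average N2 g (stopP (P i))" by (rule stopP(4)[OF i])
  next
    fix i j assume "i \<in> J" "j \<in> J" "stopP (P i) = stopP (P j)"
    then show "stopQ (Q i) = stopQ (Q j)" by (rule coh)
  qed (use Jf A(1) p s in \<open>auto simp: less_imp_le\<close>)
  have step3: "(\<Sum>X\<in>(\<lambda>i. stopP (P i)) ` J. average N2 g X powr p' * measure N2 X) \<le> embedding_const p' * ?g"
    by (rule embedding_P) (use stopP(1) J in blast)
  have step4: "(\<Sum>i\<in>J. ?a i powr p * measure N1 (Q i)) \<le> U1 * (embedding_const p * ?f)"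
  proof -
    let ?F = "(\<lambda>i. stopQ (Q i)) ` J"
    have "(\<Sum>i\<in>J. ?a i powr p * measure N1 (Q i))
        = (\<Sum>X\<in>?F. \<Sum>i\<in>{i \<in> J. stopQ (Q i) = X}. ?a i powr p * measure N1 (Q i))"
      by (rule sum.image_gen[OF Jf])
    also have "\<dots> = (\<Sum>X\<in>?F. average N1 f X powr p * (\<Sum>i\<in>{i \<in> J. stopQ (Q i) = X}. measure N1 (Q i)))"
      unfolding sum_distrib_left by (intro sum.cong) auto
    also have "\<dots> \<le> (\<Sum>X\<in>?F. average N1 f X powr p * (U1 * measure N1 X))"
    proof (intro sum_mono mult_left_mono)
      fix X assume X: "X \<in> ?F"
      have sub: "{i \<in> J. stopQ (Q i) = X} \<subseteq> {i \<in> I. Q i \<subseteq> X}" using J stopQ(2) by auto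
      have "(\<Sum>i\<in>{i \<in> J. stopQ (Q i) = X}. measure N1 (Q i)) \<le> (\<Sum>i\<in>{i \<in> I. Q i \<subseteq> X}. measure N1 (Q i))"
        by (rule sum_mono2[OF _ sub]) (use I(1) in auto)
      also have "\<dots> \<le> U1 * measure N1 X"
        by (rule packing_N1) (use X J stopQ(5) in blast)
      finally show "(\<Sum>i\<in>{i \<in> J. stopQ (Q i) = X}. measure N1 (Q i)) \<le> U1 * measure N1 X" .
    qed simp
    also have "\<dots> = U1 * (\<Sum>X\<in>?F. average N1 f X powr p * measure N1 X)"
      by (simp add: sum_distrib_left mult_ac)
    also have "\<dots> \<le> U1 * (embedding_const p * ?f)"
      by (intro mult_left_mono embedding_Q) (use U stopQ(1) J in auto)
    finally show ?thesis .
  qed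
  note step1
  also note step2
  also have "4 / (1 - ?r) * s * (\<Sum>X\<in>(\<lambda>i. stopP (P i)) ` J. average N2 g X powr p' * measure N2 X)
       + 4 * s powr (1 - p) * A * (\<Sum>i\<in>J. ?a i powr p * measure N1 (Q i))
     \<le> 4 / (1 - ?r) * s * (embedding_const p' * ?g) + 4 * s powr (1 - p) * A * (U1 * (embedding_const p * ?f))"
    using r s A(1) by (intro add_mono mult_left_mono step3 step4) auto
  finally have "(\<Sum>i\<in>J. summand i) \<le> 4 * (4 / (1 - ?r) * s * (embedding_const p' * ?g)
       + 4 * s powr (1 - p) * A * (U1 * (embedding_const p * ?f)))"
    by simp
  also have "\<dots> \<le> 16 / (1 - ?r) * (embedding_const p + embedding_const p')
    * (s * ?g + s powr (1 - p) * (A * U1 * ?f))"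
  proof -
    let ?e = "embedding_const p" and ?e' = "embedding_const p'"
    have e: "0 \<le> ?e" "0 \<le> ?e'"
      using embedding_const_pos p(1) conjugate_exponent(1)[OF p] by (auto simp: less_imp_le)
    have fg: "0 \<le> ?f" "0 \<le> ?g" by (auto intro: integral_nonneg_AE)
    define c where "c = 1 / (1 - ?r)"
    have c16: "16 / (1 - ?r) = 16 * c" by (simp add: c_def)
    let ?X = "s * ?g" and ?Y = "s powr (1 - p) * (A * U1 * ?f)"
    have c: "1 \<le> c" using r r0 by (simp add: c_def)
    have X: "0 \<le> ?X" "0 \<le> ?Y" using s fg A(1) U by auto
    have "4 * (4 / (1 - ?r) * s * (?e' * ?g) + 4 * s powr (1 - p) * A * (U1 * (?e * ?f)))
        = 16 * (c * ?e' * ?X + ?e * ?Y)" by (simp add: c_def algebra_simps)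
    also have "\<dots> \<le> 16 * (c * (?e + ?e') * ?X + c * (?e + ?e') * ?Y)"
    proof -
      have "c * ?e' * ?X \<le> c * (?e + ?e') * ?X"
        using c e X by (intro mult_right_mono mult_left_mono) auto
      moreover have "1 * ?e \<le> c * (?e + ?e')"
        using c e by (intro mult_mono) auto
      then have "?e * ?Y \<le> c * (?e + ?e') * ?Y"
        using X by (intro mult_right_mono) auto
      ultimately show ?thesis by simp
    qed
    also have "\<dots> = 16 / (1 - ?r) * (?e + ?e') * (?X + ?Y)" unfolding c16 by (simp only: distrib_left distrib_right mult.assoc)
    finally show ?thesis .
  qed
  finally show ?thesis .
qed

lemma coherent_part:
  assumes J: "J \<subseteq> I"
    and coh: "\<And>i j. i \<in> J \<Longrightarrow> j \<in> J \<Longrightarrow> stopP (P i) = stopP (P j) \<Longrightarrow> stopQ (Q i) = stopQ (Q j)"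
  shows "2 * (\<Sum>i\<in>J. summand i) \<le> half_const p p' K
    * ((A * U1 * (LINT x|N1. f x powr p)) powr (1 / p) * (LINT x|N2. g x powr p') powr (1 / p'))"
proof (cases "J = {}")
  case True
  have "0 < half_const p p' K" by (rule half_const_pos[OF p(1) conjugate_exponent(1)[OF p] K])
  then show ?thesis using True by simp
next
  case False
  then have "I \<noteq> {}" using J by auto
  then have "0 < (LINT x|N1. f x powr p)" "0 < (LINT x|N2. g x powr p')"
    using f_norm_pos g_norm_pos by auto
  then have "(\<Sum>i\<in>J. summand i) \<le> 2 * (16 / (1 - decay_ratio p (2 * K + 1)) * (embedding_const p + embedding_const p'))
    * ((A * U1 * (LINT x|N1. f x powr p)) powr (1 / p) * (LINT x|N2. g x powr p') powr (1 / p'))"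
    using A(1) U p by (intro optimize_split coherent_part_split[OF J coh]) auto
  moreover have "half_const p p' K
      = 2 * (2 * (16 / (1 - decay_ratio p (2 * K + 1)) * (embedding_const p + embedding_const p')))"
    by (simp add: half_const_def)
  ultimately show ?thesis by (simp only: mult.assoc mult_le_cancel_left_pos zero_less_numeral)
qed

text \<open>
  The two alternatives are handled separately. If \<open>P i\<close> is its own stopping cube, that cube determines
  \<open>i\<close>. Otherwise \<open>Q i\<close> lies in the stopping cube \<open>G\<close> of \<open>P i\<close>, by separation; when \<open>G\<close> lies in the
  stopping cube of \<open>Q i\<close>, the latter is the smallest record containing \<open>G\<close> and is determined by \<open>G\<close>.
\<close>
lemma half_bound:
  shows "(\<Sum>i\<in>{i \<in> I. P i = stopP (P i) \<or> stopP (P i) \<subseteq> stopQ (Q i)}. summand i) \<le> half_const p p' K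
    * ((A * U1 * (LINT x|N1. f x powr p)) powr (1 / p) * (LINT x|N2. g x powr p') powr (1 / p'))"
proof -
  define J1 where "J1 = {i \<in> I. P i = stopP (P i)}"
  define J2 where "J2 = {i \<in> I. P i \<noteq> stopP (P i) \<and> stopP (P i) \<subseteq> stopQ (Q i)}"
  have 1: "stopQ (Q i) = stopQ (Q j)" if "i \<in> J1" "j \<in> J1" "stopP (P i) = stopP (P j)" for i j
    using that I(3) by (metis (mono_tags, lifting) J1_def inj_onD mem_Collect_eq)
  have sub: "stopQ (Q i) \<subseteq> stopQ (Q j)" if ij: "i \<in> J2" "j \<in> J2" "stopP (P i) = stopP (P j)" for i j
  proof -
    have iI: "i \<in> I" and jI: "j \<in> I" using ij by (auto simp: J2_def)
    obtain k where k: "k \<in> I" "stopP (P i) = P k" using stopP(5)[OF iI] by auto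
    have "P i \<subset> P k" using ij(1) stopP(2)[OF iI] k by (auto simp: J2_def)
    then have "Q i \<subseteq> P k" using sep(2)[OF iI k(1)] R(1)[OF iI] by blast
    also have "P k \<subseteq> stopQ (Q j)" using ij k by (auto simp: J2_def)
    finally show ?thesis by (rule stopQ_le[OF iI jI])
  qed
  have 2: "stopQ (Q i) = stopQ (Q j)" if "i \<in> J2" "j \<in> J2" "stopP (P i) = stopP (P j)" for i j
    using sub[OF that] sub[OF that(2,1) that(3)[symmetric]] by blast
  have J: "J1 \<subseteq> I" "J2 \<subseteq> I" by (auto simp: J1_def J2_def)
  have J12: "{i \<in> I. P i = stopP (P i) \<or> stopP (P i) \<subseteq> stopQ (Q i)} = J1 \<union> J2"
    by (auto simp: J1_def J2_def)
  have "(\<Sum>i\<in>J1 \<union> J2. summand i) = (\<Sum>i\<in>J1. summand i) + (\<Sum>i\<in>J2. summand i)"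
  proof (rule sum.union_disjoint)
    show "finite J1" "finite J2" using I(1) J by (auto intro: finite_subset)
  qed (auto simp: J1_def J2_def)
  moreover have "2 * (\<Sum>i\<in>J1. summand i) \<le> half_const p p' K
    * ((A * U1 * (LINT x|N1. f x powr p)) powr (1 / p) * (LINT x|N2. g x powr p') powr (1 / p'))"
    by (rule coherent_part[OF J(1)]) (rule 1)
  moreover have "2 * (\<Sum>i\<in>J2. summand i) \<le> half_const p p' K
    * ((A * U1 * (LINT x|N1. f x powr p)) powr (1 / p) * (LINT x|N2. g x powr p') powr (1 / p'))"
    by (rule coherent_part[OF J(2)]) (rule 2)
  ultimately show ?thesis unfolding J12 by linarith
qed

text \<open>
  A pair that is in neither half would have \<open>Q i\<close> inside both stopping cubes, by separation, and
  these would be nested because the family is laminar, which puts the pair in one of the halves.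
\<close>
lemma sum_bound:
  shows "(\<Sum>i\<in>I. summand i) \<le> (half_const p p' K + half_const p' p K) * A powr (1 / p)
    * (U1 powr (1 / p) + U2 powr (1 / p'))
    * ((LINT x|N1. f x powr p) powr (1 / p) * (LINT x|N2. g x powr p') powr (1 / p'))"
proof -
  interpret sw: separated_pairs M N2 N1 I P Q R g f p' p K "A powr (p' - 1)" U2 U1
    by (rule swapped)
  let ?f = "LINT x|N1. f x powr p" and ?g = "LINT x|N2. g x powr p'"
  let ?n = "?f powr (1 / p) * ?g powr (1 / p')"
  have sQ: "sw.stopQ = stopP" "sw.stopP = stopQ"
    by (auto simp: sw.stopQ_def stopP_def sw.stopP_def stopQ_def intro!: ext)
  have sm: "sw.summand = summand"
    by (intro ext) (simp add: sw.summand_def summand_def sw.m_def m_def max.commute mult_ac)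
  let ?I1 = "{i \<in> I. P i = stopP (P i) \<or> stopP (P i) \<subseteq> stopQ (Q i)}"
  let ?I2 = "{i \<in> I. Q i = stopQ (Q i) \<or> stopQ (Q i) \<subseteq> stopP (P i)}"
  have cover: "I = ?I1 \<union> ?I2"
  proof
    show "I \<subseteq> ?I1 \<union> ?I2"
    proof
      fix i assume i: "i \<in> I"
      show "i \<in> ?I1 \<union> ?I2"
      proof (rule ccontr)
        assume "i \<notin> ?I1 \<union> ?I2"
        then have ne: "P i \<noteq> stopP (P i)" "\<not> stopP (P i) \<subseteq> stopQ (Q i)" "\<not> stopQ (Q i) \<subseteq> stopP (P i)"
          using i by auto
        obtain k where k: "k \<in> I" "stopP (P i) = P k" using stopP(5)[OF i] by auto
        have "P i \<subset> P k" using ne(1) stopP(2)[OF i] k by auto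
        then have "Q i \<subseteq> stopP (P i)" using sep(2)[OF i k(1)] R(1)[OF i] k(2) by blast
        moreover have "stopP (P i) \<in> Q ` I \<union> P ` I" "stopQ (Q i) \<in> Q ` I \<union> P ` I"
          using stopP(5)[OF i] stopQ(5)[OF i] by auto
        ultimately show False
          using laminar_chain[OF I(4) _ _ nonempty(1)[OF i]] stopQ(2)[OF i] ne by blast
      qed
    qed
  qed auto
  have "(\<Sum>i\<in>I. summand i) \<le> (\<Sum>i\<in>?I1. summand i) + (\<Sum>i\<in>?I2. summand i)"
  proof -
    have "(\<Sum>i\<in>?I1 \<union> ?I2. summand i) + (\<Sum>i\<in>?I1 \<inter> ?I2. summand i)
        = (\<Sum>i\<in>?I1. summand i) + (\<Sum>i\<in>?I2. summand i)"
      by (rule sum.union_inter) (use I(1) in auto)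
    moreover have "0 \<le> (\<Sum>i\<in>?I1 \<inter> ?I2. summand i)"
      by (rule sum_nonneg) (use summand_nonneg in auto)
    ultimately show ?thesis using cover by simp
  qed
  also have "(\<Sum>i\<in>?I1. summand i) \<le> half_const p p' K * (A powr (1 / p) * U1 powr (1 / p) * ?n)"
  proof -
    have "0 \<le> ?f" by (auto intro: integral_nonneg_AE)
    then have e: "(A * U1 * ?f) powr (1 / p) * ?g powr (1 / p') = A powr (1 / p) * U1 powr (1 / p) * ?n"
      using A(1) U by (simp add: powr_mult)
    show ?thesis using half_bound unfolding e .
  qed
  also have "(\<Sum>i\<in>?I2. summand i) \<le> half_const p' p K * (A powr (1 / p) * U2 powr (1 / p') * ?n)"
  proof -
    have "(p' - 1) * (1 / p') = 1 / p"
      using conjugate_exponent(1)[OF p] p by (simp add: field_simps)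
    then have "(A powr (p' - 1)) powr (1 / p') = A powr (1 / p)" by (simp add: powr_powr)
    moreover have "0 \<le> ?g" by (auto intro: integral_nonneg_AE)
    ultimately have e: "(A powr (p' - 1) * U2 * ?g) powr (1 / p') * ?f powr (1 / p)
        = A powr (1 / p) * U2 powr (1 / p') * ?n"
      using A(1) U by (simp add: powr_mult)
    show ?thesis using sw.half_bound unfolding sQ sm e .
  qed
  also have "half_const p p' K * (A powr (1 / p) * U1 powr (1 / p) * ?n)
      + half_const p' p K * (A powr (1 / p) * U2 powr (1 / p') * ?n)
    \<le> (half_const p p' K + half_const p' p K) * (A powr (1 / p) * U1 powr (1 / p) * ?n)
      + (half_const p p' K + half_const p' p K) * (A powr (1 / p) * U2 powr (1 / p') * ?n)"
  proof -
    have "0 < half_const p p' K" "0 < half_const p' p K"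
      using half_const_pos p(1) conjugate_exponent(1)[OF p] K by blast+
    then show ?thesis by (intro add_mono mult_right_mono) auto
  qed
  also have "\<dots> = (half_const p p' K + half_const p' p K) * A powr (1 / p)
    * (U1 powr (1 / p) + U2 powr (1 / p')) * ?n" by (simp add: algebra_simps)
  finally show ?thesis by simp
qed

end

section \<open>Geometry of dyadic lattices\<close>

definition side :: "(real ^ 'd) set \<Rightarrow> real" where
  "side Q = (SOME l. 0 < l \<and> (\<exists>a. Q = cube a l))"

text \<open>
  Passing to the dyadic parent raises this integer by exactly one, so it numbers the generations of
  a lattice. Rounding removes the dependence on a reference cube.
\<close>
definition log_side :: "(real ^ 'd) set \<Rightarrow> int" where
  "log_side Q = \<lfloor>log 2 (side Q)\<rfloor>"

lemma side_cube:
  fixes a :: "real ^ 'd"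
  assumes "0 < l"
  shows "side (cube a l) = l"
  unfolding side_def
proof (rule some_equality)
  fix k assume "0 < k \<and> (\<exists>b. cube a l = cube b k)"
  then show "k = l" using cube_inject(2)[OF assms] by blast
qed (use assms in auto)

lemma log_side_descendant:
  assumes P: "P \<in> cubes" and Q: "Q \<in> dyadic_descendants n P"
  shows "log_side P = log_side Q + int n"
proof -
  obtain a l where P': "P = cube a l" "0 < l" using P by (auto simp: cubes_def)
  obtain b where Q': "Q = cube b (l / 2 ^ n)"
    using dyadic_descendants_side[OF P'(2)] Q P'(1) by blast
  have "log 2 (l / 2 ^ n) = log 2 l - real n"
    using P'(2) by (simp add: log_divide log_nat_power)
  then have "\<lfloor>log 2 (l / 2 ^ n)\<rfloor> = \<lfloor>log 2 l\<rfloor> - int n"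
    using floor_diff_of_int[of "log 2 l" "int n"] by simp
  then show ?thesis using P'(2) by (simp add: P'(1) Q' log_side_def side_cube)
qed

lemma dyadic_lattice_cubes: "dyadic_lattice D \<Longrightarrow> D \<subseteq> cubes"
  by (simp add: dyadic_lattice_def)

text \<open>Below a common ancestor, the ancestor of \<open>Q\<close> of the same generation as \<open>P\<close> meets \<open>P\<close> and so equals \<open>P\<close>.\<close>
lemma dyadic_nested:
  assumes D: "dyadic_lattice D" and QP: "Q \<in> D" "P \<in> D" "Q \<inter> P \<noteq> {}" "log_side Q \<le> log_side P"
  shows "Q \<subseteq> P"
proof -
  obtain R r t where R: "R \<in> D" "Q \<in> dyadic_descendants r R" "P \<in> dyadic_descendants t R"
    using dyadic_lattice_common_ancestor[OF D QP(1,2)] by blast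
  have RC: "R \<in> cubes" using dyadic_lattice_cubes[OF D] R(1) by blast
  have "t \<le> r" using log_side_descendant[OF RC R(2)] log_side_descendant[OF RC R(3)] QP(4) by linarith
  then have "Q \<in> dyadic_descendants (t + (r - t)) R" using R(2) by simp
  then obtain T where T: "T \<in> dyadic_descendants t R" "Q \<in> dyadic_descendants (r - t) T"
    unfolding dyadic_descendants_add by blast
  have "Q \<subseteq> T" using dyadic_descendants_subset[OF T(2)] .
  moreover obtain x where "x \<in> Q" "x \<in> P" using QP(3) by blast
  ultimately have "T = P" using dyadic_descendants_disjoint[OF T(1) R(3)] by blast
  then show ?thesis using \<open>Q \<subseteq> T\<close> by simp
qed

lemma dyadic_lattice_laminar: "dyadic_lattice D \<Longrightarrow> laminar D"
  unfolding laminar_def using dyadic_nested by (metis Int_commute linear)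

text \<open>
  Dyadic distance at most \<open>\<kappa>\<close> provides such an \<open>R\<close>. The ancestor is kept as an argument because it
  is the set that separation moves inside larger cubes of a colour class.
\<close>
definition near :: "(real ^ 'd) set set \<Rightarrow> nat \<Rightarrow> (real ^ 'd) set \<Rightarrow> (real ^ 'd) set \<Rightarrow> (real ^ 'd) set \<Rightarrow> bool" where
  "near D \<kappa> Q P R \<longleftrightarrow> R \<in> D \<and>
     (\<exists>r t. r \<le> \<kappa> \<and> t \<le> \<kappa> \<and> Q \<in> dyadic_descendants r R \<and> P \<in> dyadic_descendants t R)"

lemma near_sym: "near D \<kappa> Q P R \<Longrightarrow> near D \<kappa> P Q R"
  unfolding near_def by blast

lemma dyadic_ancestor:
  assumes "dyadic_lattice D" "Q \<in> D"
  shows "dyadic_ancestor D r Q \<in> D" "Q \<in> dyadic_descendants r (dyadic_ancestor D r Q)"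
    "R \<in> D \<Longrightarrow> Q \<in> dyadic_descendants r R \<Longrightarrow> dyadic_ancestor D r Q = R"
proof -
  show "dyadic_ancestor D r Q \<in> D" "Q \<in> dyadic_descendants r (dyadic_ancestor D r Q)"
    using theI'[OF dyadic_ancestor_ex1[OF assms, of r]] by (auto simp: dyadic_ancestor_def)
  show "R \<in> D \<Longrightarrow> Q \<in> dyadic_descendants r R \<Longrightarrow> dyadic_ancestor D r Q = R"
    unfolding dyadic_ancestor_def by (rule the1_equality[OF dyadic_ancestor_ex1[OF assms]]) simp
qed

lemma near_of_complexity:
  assumes D: "dyadic_lattice D" and \<Gamma>: "\<Gamma> \<subseteq> D \<times> D" "complexity_at_most D \<Gamma> \<kappa>" "(Q, P) \<in> \<Gamma>"
  shows "\<exists>R. near D \<kappa> Q P R"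
proof -
  have QP: "Q \<in> D" "P \<in> D" using \<Gamma>(1,3) by auto
  have "dyadic_dist D Q P \<le> enat \<kappa>" using \<Gamma>(2,3) by (auto simp: complexity_at_most_def)
  also have "\<dots> < enat (Suc \<kappa>)" by simp
  finally obtain r t where rt: "r + t < Suc \<kappa>" "dyadic_ancestor D r Q = dyadic_ancestor D t P"
    unfolding dyadic_dist_def Inf_less_iff by auto
  then have "r \<le> \<kappa>" "t \<le> \<kappa>" "P \<in> dyadic_descendants t (dyadic_ancestor D r Q)"
    using dyadic_ancestor(2)[OF D QP(2), of t] by auto
  then have "near D \<kappa> Q P (dyadic_ancestor D r Q)"
    unfolding near_def using dyadic_ancestor(1,2)[OF D QP(1), of r] by blast
  then show ?thesis by blast
qed

lemma dyadic_children_finite: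
  fixes Q :: "(real ^ 'd) set"
  shows "finite (dyadic_children Q)" "card (dyadic_children Q) \<le> CARD('d \<Rightarrow> bool)"
proof -
  let ?e = "\<lambda>h::'d \<Rightarrow> bool. (\<chi> i. if h i then 1 else 0) :: real ^ 'd"
  have "\<exists>c::('d \<Rightarrow> bool) \<Rightarrow> (real ^ 'd) set. dyadic_children Q \<subseteq> range c"
  proof (cases "\<exists>a l. 0 < l \<and> Q = cube a l")
    case True
    then obtain a l where al: "0 < l" "Q = cube a l" by blast
    define c where "c h = cube (a + (l / 2) *\<^sub>R ?e h) (l / 2)" for h
    have "dyadic_children Q \<subseteq> range c"
    proof
      fix X assume "X \<in> dyadic_children Q"
      then obtain e :: "real ^ 'd" where e: "X = cube (a + (l / 2) *\<^sub>R e) (l / 2)" "\<forall>i. e $ i \<in> {0, 1}"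
        unfolding al(2) dyadic_children_cube[OF al(1)] by blast
      have "e = ?e (\<lambda>i. e $ i = 1)" using e(2) by (auto simp: vec_eq_iff)
      then have "X = c (\<lambda>i. e $ i = 1)" unfolding c_def using e(1) by metis
      then show "X \<in> range c" by simp
    qed
    then show ?thesis by (intro exI[of _ c])
  next
    case False
    then have "dyadic_children Q = {}" unfolding dyadic_children_def by blast
    then show ?thesis by simp
  qed
  then obtain c :: "('d \<Rightarrow> bool) \<Rightarrow> (real ^ 'd) set" where c: "dyadic_children Q \<subseteq> range c" by blast
  show "finite (dyadic_children Q)" by (rule finite_subset[OF c]) simp
  have "card (dyadic_children Q) \<le> card (range c)" by (rule card_mono[OF _ c]) simp
  also have "\<dots> \<le> CARD('d \<Rightarrow> bool)" by (rule card_image_le) simp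
  finally show "card (dyadic_children Q) \<le> CARD('d \<Rightarrow> bool)" .
qed

lemma dyadic_descendants_finite:
  fixes R :: "(real ^ 'd) set"
  shows "finite (dyadic_descendants n R) \<and> card (dyadic_descendants n R) \<le> CARD('d \<Rightarrow> bool) ^ n"
proof (induction n)
  case (Suc n)
  have "card (dyadic_descendants (Suc n) R)
      \<le> (\<Sum>P\<in>dyadic_descendants n R. card (dyadic_children P))"
    unfolding dyadic_descendants.simps by (rule card_UN_le) (use Suc in blast)
  also have "\<dots> \<le> card (dyadic_descendants n R) * CARD('d \<Rightarrow> bool)"
    using sum_bounded_above[of "dyadic_descendants n R" "\<lambda>P. card (dyadic_children P)"]
      dyadic_children_finite(2) by (metis of_nat_id)
  also have "\<dots> \<le> CARD('d \<Rightarrow> bool) ^ n * CARD('d \<Rightarrow> bool)"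
    using Suc by (intro mult_right_mono) auto
  finally have "card (dyadic_descendants (Suc n) R) \<le> CARD('d \<Rightarrow> bool) ^ Suc n"
    by (simp add: mult.commute)
  moreover have "finite (dyadic_descendants (Suc n) R)"
    unfolding dyadic_descendants.simps using Suc dyadic_children_finite(1) by blast
  ultimately show ?case by blast
qed simp

text \<open>A bound for the number of partners of a cube: at most \<open>\<kappa> + 1\<close> choices for each generation gap, then a descendant of the ancestor.\<close>
definition near_bound :: "'d::finite itself \<Rightarrow> nat \<Rightarrow> nat" where
  "near_bound _ \<kappa> = Suc \<kappa> * (Suc \<kappa> * CARD('d \<Rightarrow> bool) ^ \<kappa>)"

lemma near_finite:
  fixes Q :: "(real ^ 'd) set"
  assumes D: "dyadic_lattice D" "Q \<in> D"
  shows "finite {P. \<exists>R. near D \<kappa> Q P R}" "card {P. \<exists>R. near D \<kappa> Q P R} \<le> near_bound TYPE('d) \<kappa>"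
proof -
  let ?U = "\<Union>r\<in>{..\<kappa>}. \<Union>t\<in>{..\<kappa>}. dyadic_descendants t (dyadic_ancestor D r Q)"
  have sub: "{P. \<exists>R. near D \<kappa> Q P R} \<subseteq> ?U"
  proof
    fix P assume "P \<in> {P. \<exists>R. near D \<kappa> Q P R}"
    then obtain R r t where "R \<in> D" "r \<le> \<kappa>" "t \<le> \<kappa>" "Q \<in> dyadic_descendants r R" "P \<in> dyadic_descendants t R"
      unfolding near_def by blast
    then show "P \<in> ?U" using dyadic_ancestor(3)[OF D, of R r] by blast
  qed
  have fin: "finite ?U" using dyadic_descendants_finite by blast
  show "finite {P. \<exists>R. near D \<kappa> Q P R}" by (rule finite_subset[OF sub fin])
  have "card {P. \<exists>R. near D \<kappa> Q P R} \<le> card ?U" by (rule card_mono[OF fin sub])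
  also have "\<dots> \<le> (\<Sum>r\<in>{..\<kappa>}. card (\<Union>t\<in>{..\<kappa>}. dyadic_descendants t (dyadic_ancestor D r Q)))"
    by (rule card_UN_le) simp
  also have "\<dots> \<le> (\<Sum>r\<in>{..\<kappa>}. \<Sum>t\<in>{..\<kappa>}. card (dyadic_descendants t (dyadic_ancestor D r Q)))"
    by (intro sum_mono card_UN_le) simp
  also have "\<dots> \<le> (\<Sum>r\<in>{..\<kappa>}. \<Sum>t\<in>{..\<kappa>}. CARD('d \<Rightarrow> bool) ^ \<kappa>)"
  proof (intro sum_mono)
    fix r t :: nat assume "t \<in> {..\<kappa>}"
    then have "CARD('d \<Rightarrow> bool) ^ t \<le> CARD('d \<Rightarrow> bool) ^ \<kappa>"
      by (intro power_increasing) (auto simp: Suc_le_eq)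
    then show "card (dyadic_descendants t (dyadic_ancestor D r Q)) \<le> CARD('d \<Rightarrow> bool) ^ \<kappa>"
      using dyadic_descendants_finite[of t "dyadic_ancestor D r Q"] by linarith
  qed
  also have "\<dots> = near_bound TYPE('d) \<kappa>" by (simp add: near_bound_def)
  finally show "card {P. \<exists>R. near D \<kappa> Q P R} \<le> near_bound TYPE('d) \<kappa>" .
qed

text \<open>
  The generations of \<open>Q\<close> and \<open>Q'\<close> differ by a positive multiple of \<open>\<kappa> + 1\<close>, while \<open>R\<close> is at most \<open>\<kappa>\<close>
  generations above \<open>Q\<close>; thus \<open>R\<close> is not larger than \<open>Q'\<close>, and it meets \<open>Q'\<close>.
\<close>
lemma near_separated:
  assumes D: "dyadic_lattice D" and QP: "Q \<in> D" "Q' \<in> D" "Q \<noteq> {}" "Q \<subset> Q'"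
    and mod: "log_side Q mod (int \<kappa> + 1) = log_side Q' mod (int \<kappa> + 1)"
    and R: "near D \<kappa> Q P R"
  shows "R \<subseteq> Q'"
proof -
  have RD: "R \<in> D" using R by (simp add: near_def)
  obtain r where r: "r \<le> \<kappa>" "Q \<in> dyadic_descendants r R" using R by (auto simp: near_def)
  have RC: "R \<in> cubes" using dyadic_lattice_cubes[OF D] RD by blast
  have QR: "Q \<subseteq> R" by (rule dyadic_descendants_subset[OF r(2)])
  have lt: "log_side Q < log_side Q'"
  proof (rule ccontr)
    assume "\<not> log_side Q < log_side Q'"
    then have "Q' \<subseteq> Q" by (intro dyadic_nested[OF D]) (use QP in auto)
    then show False using QP(4) by auto
  qed
  have "(int \<kappa> + 1) dvd (log_side Q' - log_side Q)" using mod by (metis mod_eq_dvd_iff)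
  then have "int \<kappa> + 1 \<le> log_side Q' - log_side Q" using lt by (intro zdvd_imp_le) auto
  then have "log_side R \<le> log_side Q'" using log_side_descendant[OF RC r(2)] r(1) by linarith
  then show ?thesis by (intro dyadic_nested[OF D]) (use RD QP QR in auto)
qed

lemma bounded_degree_labelling:
  assumes "\<And>x. x \<in> X \<Longrightarrow> finite (T x) \<and> card (T x) \<le> N"
  shows "\<exists>c. \<forall>x\<in>X. inj_on (c x) (T x) \<and> c x ` T x \<subseteq> {..<N::nat}"
proof -
  have "\<exists>c. inj_on c (T x) \<and> c ` T x \<subseteq> {..<N}" if x: "x \<in> X" for x
  proof -
    obtain c where c: "bij_betw c (T x) {0..<card (T x)}"
      using ex_bij_betw_finite_nat assms[OF x] by blast
    then have "c ` T x \<subseteq> {..<N}" using assms[OF x] by (auto simp: bij_betw_def)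
    then show ?thesis using c by (auto simp: bij_betw_def)
  qed
  then show ?thesis by metis
qed

lemma sum_colour_classes_le:
  fixes h :: "'i \<Rightarrow> real"
  assumes "finite I" "finite C" "col ` I \<subseteq> C" "0 \<le> B"
    and "\<And>c. (\<Sum>i\<in>{i \<in> I. col i = c}. h i) \<le> B"
  shows "(\<Sum>i\<in>I. h i) \<le> real (card C) * B"
proof -
  have "(\<Sum>i\<in>I. h i) = (\<Sum>c\<in>col ` I. \<Sum>i\<in>{i \<in> I. col i = c}. h i)"
    by (rule sum.image_gen[OF assms(1)])
  also have "\<dots> \<le> real (card (col ` I)) * B" by (rule sum_bounded_above) (rule assms(5))
  also have "\<dots> \<le> real (card C) * B"
    using assms by (intro mult_right_mono) (auto intro: card_mono)
  finally show ?thesis .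
qed

text \<open>
  The colour of a pair records both generations modulo \<open>\<kappa> + 1\<close>, the label of \<open>P\<close> among the partners of \<open>Q\<close>
  and the label of \<open>Q\<close> among the partners of \<open>P\<close>. The labels make every colour class a matching, the
  residues make it separated.
\<close>
lemma separated_colouring:
  fixes D :: "(real ^ 'd) set set"
  assumes D: "dyadic_lattice D" and I: "finite I" "I \<subseteq> D \<times> D"
    and near: "\<forall>z\<in>I. \<exists>R. near D \<kappa> (fst z) (snd z) R"
  shows "\<exists>col :: (real ^ 'd) set \<times> (real ^ 'd) set \<Rightarrow> (int \<times> int) \<times> nat \<times> nat.
    col ` I \<subseteq> ({0..int \<kappa>} \<times> {0..int \<kappa>}) \<times> {..<near_bound TYPE('d) \<kappa>} \<times> {..<near_bound TYPE('d) \<kappa>} \<and>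
    (\<forall>z\<in>I. \<forall>w\<in>I. col z = col w \<longrightarrow>
       (fst z = fst w \<or> snd z = snd w \<longrightarrow> z = w) \<and>
       log_side (fst z) mod (int \<kappa> + 1) = log_side (fst w) mod (int \<kappa> + 1) \<and>
       log_side (snd z) mod (int \<kappa> + 1) = log_side (snd w) mod (int \<kappa> + 1))"
proof -
  let ?N = "near_bound TYPE('d) \<kappa>" and ?T = "\<lambda>Q. {P. \<exists>R. near D \<kappa> Q P R}"
  obtain c where c: "\<And>Q. Q \<in> D \<Longrightarrow> inj_on (c Q) (?T Q)" "\<And>Q. Q \<in> D \<Longrightarrow> c Q ` ?T Q \<subseteq> {..<?N}"
    using bounded_degree_labelling[of D ?T ?N] near_finite[OF D] by metis
  define col where "col = (\<lambda>(Q, P). ((log_side Q mod (int \<kappa> + 1), log_side P mod (int \<kappa> + 1)), c Q P, c P Q))"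
  have nr: "fst z \<in> D" "snd z \<in> D" "snd z \<in> ?T (fst z)" "fst z \<in> ?T (snd z)" if "z \<in> I" for z
  proof -
    show "fst z \<in> D" "snd z \<in> D" using that I(2) by auto
    have "\<exists>R. near D \<kappa> (fst z) (snd z) R" using near that by blast
    then show "snd z \<in> ?T (fst z)" "fst z \<in> ?T (snd z)" using near_sym by blast+
  qed
  have mod: "x mod (int \<kappa> + 1) \<in> {0..int \<kappa>}" for x :: int
    using pos_mod_bound[of "int \<kappa> + 1" x] pos_mod_sign[of "int \<kappa> + 1" x] by auto
  have "col z \<in> ({0..int \<kappa>} \<times> {0..int \<kappa>}) \<times> {..<?N} \<times> {..<?N}" if z: "z \<in> I" for z
  proof -
    have "c (fst z) (snd z) \<in> {..<?N}" "c (snd z) (fst z) \<in> {..<?N}"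
      using c(2)[OF nr(1)[OF z]] c(2)[OF nr(2)[OF z]] nr(3,4)[OF z] by blast+
    then show ?thesis using mod by (simp add: col_def case_prod_beta)
  qed
  moreover have "z = w" if zw: "z \<in> I" "w \<in> I" "col z = col w" "fst z = fst w \<or> snd z = snd w" for z w
    using zw(4)
  proof
    assume e: "fst z = fst w"
    have "c (fst z) (snd z) = c (fst z) (snd w)"
      using zw(3) e by (simp add: col_def case_prod_beta)
    then have "snd z = snd w"
      using c(1)[OF nr(1)[OF zw(1)]] nr(3)[OF zw(1)] nr(3)[OF zw(2)] e by (simp add: inj_on_def)
    then show ?thesis using e by (simp add: prod_eq_iff)
  next
    assume e: "snd z = snd w"
    have "c (snd z) (fst z) = c (snd z) (fst w)"
      using zw(3) e by (simp add: col_def case_prod_beta)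
    then have "fst z = fst w"
      using c(1)[OF nr(2)[OF zw(1)]] nr(4)[OF zw(1)] nr(4)[OF zw(2)] e by (simp add: inj_on_def)
    then show ?thesis using e by (simp add: prod_eq_iff)
  qed
  moreover have "log_side (fst z) mod (int \<kappa> + 1) = log_side (fst w) mod (int \<kappa> + 1)"
    "log_side (snd z) mod (int \<kappa> + 1) = log_side (snd w) mod (int \<kappa> + 1)" if "col z = col w" for z w
    using that by (auto simp: col_def case_prod_beta)
  ultimately show ?thesis by (intro exI[of _ col]) blast
qed

section \<open>Weights, sparse families and packing\<close>

lemma cube_borel: "cube (a :: real ^ 'd) l \<in> sets borel"
proof -
  have "cube a l = (\<Inter>i. {x. x $ i \<ge> a $ i} \<inter> {x. x $ i < a $ i + l})"
    by (auto simp: cube_def)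
  also have "\<dots> \<in> sets borel"
    by (intro sets.finite_INT sets.Int borel_closed borel_open
        closed_halfspace_component_ge_cart open_halfspace_component_lt_cart) auto
  finally show ?thesis .
qed

lemma cube_subset_cbox: "cube (a :: real ^ 'd) l \<subseteq> cbox a (\<chi> i. a $ i + l)"
  by (auto simp: cube_def mem_box_cart less_imp_le)

lemma emeasure_compact_finite:
  assumes M: "locally_finite_borel M" and K: "compact K"
  shows "emeasure M K < \<infinity>"
proof -
  obtain U where U: "\<And>x. open (U x)" "\<And>x. x \<in> U x" "\<And>x. emeasure M (U x) < \<infinity>"
    using M unfolding locally_finite_borel_def by metis
  obtain C where C: "finite C" "K \<subseteq> (\<Union>x\<in>C. U x)"
  proof (rule compactE_image[OF K])
    show "\<And>x. x \<in> K \<Longrightarrow> open (U x)" by (rule U(1))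
    show "K \<subseteq> (\<Union>x\<in>K. U x)" using U(2) by blast
  qed (rule that)
  have sets: "U x \<in> sets M" for x
    using M U(1) unfolding locally_finite_borel_def by auto
  have "emeasure M K \<le> emeasure M (\<Union>x\<in>C. U x)"
    using sets C(1) by (intro emeasure_mono C sets.finite_UN) auto
  also have "\<dots> \<le> (\<Sum>x\<in>C. emeasure M (U x))"
    using sets C(1) by (intro emeasure_subadditive_finite) auto
  also have "\<dots> < \<infinity>" using U(3) C(1) by (simp add: less_top[symmetric])
  finally show ?thesis .
qed

lemma dyadic_cube_measure:
  assumes M: "locally_finite_borel M" and D: "dyadic_lattice D" "Q \<in> D"
  shows "Q \<in> sets M" "emeasure M Q < \<infinity>" "Q \<noteq> {}"
    and "weight M v \<Longrightarrow> set_integrable M Q v"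
proof -
  have "Q \<in> cubes" using D by (auto simp: dyadic_lattice_def)
  then obtain a l where Q: "Q = cube a l" "0 < l" by (auto simp: cubes_def)
  let ?K = "cbox a (\<chi> i. a $ i + l)"
  show QM: "Q \<in> sets M"
    using M cube_borel[of a l] unfolding Q(1) locally_finite_borel_def by simp
  have K: "?K \<in> sets M" using M unfolding locally_finite_borel_def by simp
  have QK: "Q \<subseteq> ?K" unfolding Q(1) by (rule cube_subset_cbox)
  have "emeasure M Q \<le> emeasure M ?K" by (rule emeasure_mono[OF QK K])
  also have "\<dots> < \<infinity>" by (rule emeasure_compact_finite[OF M compact_cbox])
  finally show "emeasure M Q < \<infinity>" .
  have "a \<in> Q" using Q by (simp add: cube_def)
  then show "Q \<noteq> {}" by blast
  show "set_integrable M Q v" if "weight M v"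
    using set_integrable_subset[OF _ QM QK, of v] that compact_cbox unfolding weight_def by blast
qed

text \<open>Positivity uses that a weight is positive almost everywhere, so that a set of positive measure cannot be a null set for it.\<close>
lemma weighted_measure:
  assumes v: "weight M v" and Q: "Q \<in> sets M" "set_integrable M Q v"
  shows "emeasure (weighted M v) Q = ennreal (LINT x:Q|M. v x)"
    "measure (weighted M v) Q = (LINT x:Q|M. v x)"
    "0 < emeasure M Q \<Longrightarrow> 0 < (LINT x:Q|M. v x)"
proof -
  have vm[measurable]: "v \<in> borel_measurable M" and v0: "AE x in M. 0 < v x"
    using v by (auto simp: weight_def)
  have [measurable]: "Q \<in> sets M" by fact
  have "emeasure (weighted M v) Q = (\<integral>\<^sup>+x. ennreal (v x) * indicator Q x \<partial>M)"
    by (rule emeasure_density) auto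
  also have "\<dots> = (\<integral>\<^sup>+x. ennreal (indicator Q x *\<^sub>R v x) \<partial>M)"
    by (intro nn_integral_cong) (auto simp: indicator_def)
  also have "\<dots> = ennreal (LINT x:Q|M. v x)"
    unfolding set_lebesgue_integral_def
    using Q(2) v0 by (intro nn_integral_eq_integral) (auto simp: set_integrable_def elim!: eventually_mono)
  finally show e: "emeasure (weighted M v) Q = ennreal (LINT x:Q|M. v x)" .
  have nn: "0 \<le> (LINT x:Q|M. v x)"
    unfolding set_lebesgue_integral_def
    using v0 by (intro integral_nonneg_AE) (auto elim!: eventually_mono)
  show "measure (weighted M v) Q = (LINT x:Q|M. v x)"
    by (rule measure_eq_emeasure_eq_ennreal[OF nn e])
  assume pos: "0 < emeasure M Q"
  show "0 < (LINT x:Q|M. v x)"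
  proof (rule ccontr)
    assume "\<not> ?thesis"
    then have "emeasure (weighted M v) Q = 0" using e nn by simp
    then have "(\<integral>\<^sup>+x. ennreal (v x) * indicator Q x \<partial>M) = 0"
      by (simp add: emeasure_density)
    then have "AE x in M. ennreal (v x) * indicator Q x = 0"
      by (subst (asm) nn_integral_0_iff_AE) auto
    with v0 have "AE x in M. x \<notin> Q"
      by eventually_elim (auto simp: indicator_def ennreal_eq_0_iff split: if_splits)
    moreover have "(AE x in M. x \<notin> Q) \<longleftrightarrow> emeasure M Q = 0"
      by (rule AE_iff_measurable[OF Q(1)]) (use sets.sets_into_space[OF Q(1)] in auto)
    ultimately have "emeasure M Q = 0" by simp
    then show False using pos by simp
  qed
qed

lemma sparse_packing:
  assumes M: "locally_finite_borel M" and D: "dyadic_lattice D" and S: "S \<subseteq> D" "eta_sparse M \<eta> S"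
    and \<eta>: "0 < \<eta>" and J: "finite J" "inj_on Q J" "\<And>i. i \<in> J \<Longrightarrow> Q i \<in> S" "\<And>i. i \<in> J \<Longrightarrow> Q i \<subseteq> X"
    and X: "X \<in> D"
  shows "(\<Sum>i\<in>J. measure M (Q i)) \<le> 1 / \<eta> * measure M X"
proof -
  obtain E where E: "\<And>Q. Q \<in> S \<Longrightarrow> E Q \<in> sets M" "\<And>Q. Q \<in> S \<Longrightarrow> E Q \<subseteq> Q"
    "\<And>Q. Q \<in> S \<Longrightarrow> ennreal \<eta> * emeasure M Q \<le> emeasure M (E Q)" "disjoint_family_on E S"
    using S(2) unfolding eta_sparse_def by blast
  have "(\<Sum>i\<in>J. \<eta> * measure M (Q i)) \<le> (\<Sum>i\<in>J. measure M (E (Q i)))"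
  proof (rule sum_mono)
    fix i assume "i \<in> J"
    then have Q: "Q i \<in> S" "Q i \<in> D" using J S by auto
    note mQ = dyadic_cube_measure[OF M D Q(2)]
    have "emeasure M (E (Q i)) \<le> emeasure M (Q i)" by (rule emeasure_mono[OF E(2)[OF Q(1)] mQ(1)])
    then have "emeasure M (E (Q i)) < \<infinity>" using mQ(2) by (rule le_less_trans)
    then have "ennreal \<eta> * ennreal (measure M (Q i)) \<le> ennreal (measure M (E (Q i)))"
      using E(3)[OF Q(1)] mQ(2) by (simp add: emeasure_eq_ennreal_measure less_top)
    then show "\<eta> * measure M (Q i) \<le> measure M (E (Q i))"
      using \<eta> by (simp add: ennreal_mult[symmetric])
  qed
  also have "\<dots> \<le> measure M X"
  proof (rule sum_measure_disjoint_le[OF J(1)])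
    show "disjoint_family_on (\<lambda>i. E (Q i)) J"
      unfolding disjoint_family_on_def
    proof (intro ballI impI)
      fix i j assume ij: "i \<in> J" "j \<in> J" "i \<noteq> j"
      then have "Q i \<noteq> Q j" using J(2) by (auto dest: inj_onD)
      then show "E (Q i) \<inter> E (Q j) = {}"
        by (rule disjoint_family_onD[OF E(4) J(3)[OF ij(1)] J(3)[OF ij(2)]])
    qed
    show "X \<in> sets M" "emeasure M X < \<infinity>" using dyadic_cube_measure[OF M D X] by auto
    fix i assume i: "i \<in> J"
    show "E (Q i) \<in> sets M" by (rule E(1)[OF J(3)[OF i]])
    show "E (Q i) \<subseteq> X" using E(2)[OF J(3)[OF i]] J(4)[OF i] by (rule subset_trans)
  qed
  finally show ?thesis using \<eta> by (simp add: sum_distrib_left[symmetric] field_simps)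
qed

text \<open>
  On the disjoint sets \<open>E (Q i)\<close> the averages of \<open>v\<close> over the cubes \<open>Q i\<close> are bounded by the dyadic
  maximal function of \<open>v\<close> restricted to \<open>X\<close>, and \<open>E (Q i)\<close> has at least the fraction \<open>\<eta>\<close> of the
  measure of \<open>Q i\<close>. Integrating over \<open>X\<close> brings in the \<open>A\<^sub>\<infinity>\<close> constant.
\<close>
lemma Ainf_packing:
  assumes M: "locally_finite_borel M" and D: "dyadic_lattice D" and S: "S \<subseteq> D" "eta_sparse M \<eta> S"
    and \<eta>: "0 < \<eta>" and J: "finite J" "inj_on Q J" "\<And>i. i \<in> J \<Longrightarrow> Q i \<in> S" "\<And>i. i \<in> J \<Longrightarrow> Q i \<subseteq> X"
    and pos: "\<And>i. i \<in> J \<Longrightarrow> 0 < emeasure M (Q i)"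
    and X: "X \<in> D" "0 < emeasure M X" and v: "weight M v"
    and U: "Ainf_char M D v \<le> ennreal U" "0 \<le> U"
  shows "(\<Sum>i\<in>J. LINT x:Q i|M. v x) \<le> U / \<eta> * (LINT x:X|M. v x)"
proof -
  obtain E where E: "\<And>Q. Q \<in> S \<Longrightarrow> E Q \<in> sets M" "\<And>Q. Q \<in> S \<Longrightarrow> E Q \<subseteq> Q"
    "\<And>Q. Q \<in> S \<Longrightarrow> ennreal \<eta> * emeasure M Q \<le> emeasure M (E Q)" "disjoint_family_on E S"
    using S(2) unfolding eta_sparse_def by blast
  have vm[measurable]: "v \<in> borel_measurable M" and v0: "AE x in M. 0 < v x"
    using v by (auto simp: weight_def)
  let ?v = "\<lambda>Y. LINT x:Y|M. v x"
  let ?M = "dyadic_maximal M D (\<lambda>y. v y * indicator X y)"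
  define h where "h x = (\<Sum>i\<in>J. ennreal (?v (Q i)) / emeasure M (Q i) * indicator (E (Q i)) x)" for x
  have QJ: "Q i \<in> S" "Q i \<in> D" if "i \<in> J" for i using J(3)[OF that] S(1) by auto
  have [measurable]: "E (Q i) \<in> sets M" if "i \<in> J" for i using E(1) QJ that by auto
  note mX = dyadic_cube_measure[OF M D X(1)]
  have vX: "0 < ?v X" by (rule weighted_measure(3)[OF v mX(1) mX(4)[OF v] X(2)])
  have lower: "ennreal \<eta> * ennreal (?v (Q i)) \<le> ennreal (?v (Q i)) / emeasure M (Q i) * emeasure M (E (Q i))"
    if i: "i \<in> J" for i
  proof -
    note mQ = dyadic_cube_measure[OF M D QJ(2)[OF i]]
    have "ennreal \<eta> * ennreal (?v (Q i)) = ennreal (?v (Q i)) / emeasure M (Q i) * (ennreal \<eta> * emeasure M (Q i))"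
    proof -
      have "ennreal \<eta> * emeasure M (Q i) / emeasure M (Q i) = ennreal \<eta>"
        using pos[OF i] mQ(2) by (intro mult_divide_eq_ennreal) auto
      then show ?thesis unfolding ennreal_divide_times by (simp only: mult.commute)
    qed
    also have "\<dots> \<le> ennreal (?v (Q i)) / emeasure M (Q i) * emeasure M (E (Q i))"
      by (intro mult_left_mono E(3) QJ i) simp
    finally show ?thesis .
  qed
  have avg_le: "ennreal (?v (Q i)) / emeasure M (Q i) \<le> ?M x" if i: "i \<in> J" and x: "x \<in> Q i" for i x
  proof -
    note mQ = dyadic_cube_measure[OF M D QJ(2)[OF i]]
    have "ennreal (?v (Q i)) = emeasure (weighted M v) (Q i)"
      by (rule weighted_measure(1)[OF v mQ(1) mQ(4)[OF v], symmetric])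
    also have "\<dots> = (\<integral>\<^sup>+y. ennreal (v y) * indicator (Q i) y \<partial>M)"
      by (rule emeasure_density) (use mQ(1) in auto)
    also have "\<dots> \<le> (\<integral>\<^sup>+y\<in>Q i. ennreal \<bar>v y * indicator X y\<bar> \<partial>M)"
      using J(4)[OF i] by (intro nn_integral_mono) (auto simp: indicator_def ennreal_leI)
    finally have "ennreal (?v (Q i)) / emeasure M (Q i)
        \<le> (\<integral>\<^sup>+y\<in>Q i. ennreal \<bar>v y * indicator X y\<bar> \<partial>M) / emeasure M (Q i) * indicator (Q i) x"
      using x by (simp add: divide_right_mono_ennreal)
    also have "\<dots> \<le> ?M x"
      unfolding dyadic_maximal_def by (rule SUP_upper) (use QJ(2)[OF i] pos[OF i] in auto)
    finally show ?thesis .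
  qed
  have h_le: "h x \<le> ?M x * indicator X x" for x
  proof (cases "\<exists>j\<in>J. x \<in> E (Q j)")
    case True
    then obtain j where j: "j \<in> J" "x \<in> E (Q j)" by blast
    have other: "x \<notin> E (Q i)" if "i \<in> J" "i \<noteq> j" for i
    proof -
      have "Q i \<noteq> Q j" using J(2) that j(1) by (auto dest: inj_onD)
      then have "E (Q i) \<inter> E (Q j) = {}"
        by (rule disjoint_family_onD[OF E(4) QJ(1)[OF that(1)] QJ(1)[OF j(1)]])
      then show ?thesis using j(2) by blast
    qed
    have "h x = (\<Sum>i\<in>{j}. ennreal (?v (Q i)) / emeasure M (Q i) * indicator (E (Q i)) x)"
      unfolding h_def using J(1) j other by (intro sum.mono_neutral_right) auto
    also have "\<dots> = ennreal (?v (Q j)) / emeasure M (Q j)" using j by simp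
    also have "\<dots> \<le> ?M x" using avg_le[OF j(1)] E(2)[OF QJ(1)[OF j(1)]] j(2) by blast
    also have "\<dots> = ?M x * indicator X x"
      using E(2)[OF QJ(1)[OF j(1)]] J(4)[OF j(1)] j(2) by (auto simp: indicator_def)
    finally show ?thesis .
  next
    case False
    then have "h x = 0" by (simp add: h_def)
    then show ?thesis by simp
  qed
  have v_nonneg: "0 \<le> ?v (Q i)" if "i \<in> J" for i
    using weighted_measure(3)[OF v _ _ pos[OF that]] dyadic_cube_measure[OF M D QJ(2)[OF that]] v
    by (simp add: less_imp_le)
  have "ennreal (\<eta> * (\<Sum>i\<in>J. ?v (Q i))) = (\<Sum>i\<in>J. ennreal \<eta> * ennreal (?v (Q i)))"
    using \<eta> v_nonneg by (simp add: ennreal_mult sum_nonneg sum_distrib_left sum_ennreal[symmetric])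
  also have "\<dots> \<le> (\<Sum>i\<in>J. ennreal (?v (Q i)) / emeasure M (Q i) * emeasure M (E (Q i)))"
    by (rule sum_mono) (rule lower)
  also have "\<dots> = (\<integral>\<^sup>+x. h x \<partial>M)"
    unfolding h_def by (subst nn_integral_sum) (auto intro!: sum.cong simp: nn_integral_cmult_indicator)
  also have "\<dots> \<le> (\<integral>\<^sup>+x\<in>X. ?M x \<partial>M)"
    by (rule nn_integral_mono) (rule h_le)
  also have "\<dots> = (\<integral>\<^sup>+x\<in>X. ?M x \<partial>M) / ennreal (?v X) * ennreal (?v X)"
    using vX by (simp add: ennreal_divide_times)
  also have "\<dots> \<le> Ainf_char M D v * ennreal (?v X)"
    unfolding Ainf_char_def by (intro mult_right_mono SUP_upper) (use X in auto)
  also have "\<dots> \<le> ennreal U * ennreal (?v X)" by (intro mult_right_mono U) simp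
  also have "\<dots> = ennreal (U * ?v X)" using U(2) vX by (simp add: ennreal_mult)
  finally have "\<eta> * (\<Sum>i\<in>J. ?v (Q i)) \<le> U * ?v X"
    using U(2) vX by simp
  then show ?thesis using \<eta> by (simp add: field_simps)
qed

section \<open>The bilinear form\<close>

lemma Ap_summand_rescale:
  fixes q r W s p :: real
  assumes "0 < q" "0 < r" "0 < s"
  shows "W * s powr (p - 1) / max q r powr p
    = min q r powr p / (q * r powr (p - 1)) * (W / r) * (s / q) powr (p - 1)"
proof -
  have "min q r powr p * max q r powr p = (min q r * max q r) powr p"
    using assms by (simp add: powr_mult)
  also have "min q r * max q r = q * r" by (simp add: min_def max_def)
  also have "(q * r) powr p = (q powr (p - 1) * q) * (r powr (p - 1) * r)"
    using assms by (simp add: powr_mult powr_diff)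
  finally have e: "min q r powr p * max q r powr p = (q powr (p - 1) * q) * (r powr (p - 1) * r)" .
  have "min q r powr p / (q * r powr (p - 1)) * (W / r) * (s / q) powr (p - 1) * max q r powr p
      = (min q r powr p * max q r powr p) / (q * r powr (p - 1)) * (W / r) * (s powr (p - 1) / q powr (p - 1))"
    using assms by (simp add: powr_divide)
  also have "\<dots> = W * s powr (p - 1)"
    unfolding e using assms by simp
  finally have "min q r powr p / (q * r powr (p - 1)) * (W / r) * (s / q) powr (p - 1) * max q r powr p
      = W * s powr (p - 1)" .
  moreover have "max q r powr p \<noteq> 0" using assms(1) by (simp add: max_def)
  ultimately show ?thesis by (metis nonzero_mult_div_cancel_right)
qed

lemma measure_positive:
  "0 < emeasure M Q \<Longrightarrow> emeasure M Q < \<infinity> \<Longrightarrow> 0 < measure M Q"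
  by (simp add: measure_def enn2real_positive_iff)

lemma average_weighted_bound:
  fixes f :: "real ^ 'd \<Rightarrow> complex"
  assumes v: "weight M v" and Q: "Q \<in> sets M" and f: "f \<in> borel_measurable M"
  shows "norm (avg M (\<lambda>x. f x * of_real (v x)) Q)
    \<le> (LINT x:Q|weighted M v. norm (f x)) / measure M Q"
proof -
  have [measurable]: "v \<in> borel_measurable M" "Q \<in> sets M" "f \<in> borel_measurable M"
    using assms by (auto simp: weight_def)
  have v0: "AE x in M. 0 \<le> v x" using v by (auto simp: weight_def elim!: eventually_mono)
  have "norm (LINT x:Q|M. f x * of_real (v x))
      \<le> (LINT x|M. norm (indicator Q x *\<^sub>R (f x * of_real (v x))))"
    unfolding set_lebesgue_integral_def by (rule integral_norm_bound)
  also have "\<dots> = (LINT x|M. v x *\<^sub>R (indicator Q x *\<^sub>R norm (f x)))"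
    using v0 by (intro integral_cong_AE) (auto simp: norm_mult indicator_def elim!: eventually_mono)
  also have "\<dots> = (LINT x:Q|weighted M v. norm (f x))"
    unfolding set_lebesgue_integral_def using v0 by (intro integral_density[symmetric]) auto
  finally have "norm (LINT x:Q|M. f x * of_real (v x)) \<le> (LINT x:Q|weighted M v. norm (f x))" .
  then show ?thesis by (simp add: avg_def divide_right_mono)
qed

text \<open>
  The summand of the form after \<open>min q r / (q * r) = 1 / max q r\<close>, written with weighted averages
  so that it is the summand of the abstract estimate.
\<close>
definition form_majorant :: "(real ^ 'd) measure \<Rightarrow> (real ^ 'd \<Rightarrow> real) \<Rightarrow> (real ^ 'd \<Rightarrow> real)
    \<Rightarrow> (real ^ 'd \<Rightarrow> complex) \<Rightarrow> (real ^ 'd \<Rightarrow> complex) \<Rightarrow> (real ^ 'd) set \<times> (real ^ 'd) set \<Rightarrow> real" where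
  "form_majorant M \<sigma> \<omega> f g z =
     average (weighted M \<sigma>) (\<lambda>x. norm (f x)) (fst z) * average (weighted M \<omega>) (\<lambda>x. norm (g x)) (snd z)
     * (measure (weighted M \<sigma>) (fst z) * measure (weighted M \<omega>) (snd z)
        / max (measure M (fst z)) (measure M (snd z)))"

lemma average_nonneg: "(\<And>x. 0 \<le> f x) \<Longrightarrow> 0 \<le> average N f X"
  by (auto simp: average_def set_lebesgue_integral_def intro!: divide_nonneg_nonneg integral_nonneg_AE)

lemma form_term_le_majorant:
  fixes f g :: "real ^ 'd \<Rightarrow> complex"
  assumes M: "locally_finite_borel M" and D: "dyadic_lattice D"
    and QP: "Q \<in> D" "P \<in> D" "0 < emeasure M Q" "0 < emeasure M P"
    and w: "weight M \<sigma>" "weight M \<omega>" and fg: "f \<in> borel_measurable M" "g \<in> borel_measurable M"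
  shows "norm (form_term M (\<lambda>x. f x * of_real (\<sigma> x)) (\<lambda>x. g x * of_real (\<omega> x)) (Q, P))
    \<le> form_majorant M \<sigma> \<omega> f g (Q, P)"
proof -
  note mQ = dyadic_cube_measure[OF M D QP(1)] and mP = dyadic_cube_measure[OF M D QP(2)]
  let ?q = "measure M Q" and ?r = "measure M P"
  let ?a = "LINT x:Q|weighted M \<sigma>. norm (f x)" and ?b = "LINT x:P|weighted M \<omega>. norm (g x)"
  have qr: "0 < ?q" "0 < ?r" using QP mQ(2) mP(2) by (auto intro: measure_positive)
  have s: "0 < measure (weighted M \<sigma>) Q" "0 < measure (weighted M \<omega>) P"
    using weighted_measure(2,3)[OF w(1) mQ(1) mQ(4)[OF w(1)]]
      weighted_measure(2,3)[OF w(2) mP(1) mP(4)[OF w(2)]] QP(3,4) by auto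
  have ab: "0 \<le> ?a" "0 \<le> ?b" by (auto simp: set_lebesgue_integral_def intro!: integral_nonneg_AE)
  have "norm (form_term M (\<lambda>x. f x * of_real (\<sigma> x)) (\<lambda>x. g x * of_real (\<omega> x)) (Q, P))
      = norm (avg M (\<lambda>x. f x * of_real (\<sigma> x)) Q) * norm (avg M (\<lambda>x. g x * of_real (\<omega> x)) P) * min ?q ?r"
    using qr by (simp add: form_term_def norm_mult min_measure_def)
  also have "\<dots> \<le> (?a / ?q) * (?b / ?r) * min ?q ?r"
    using average_weighted_bound[OF w(1) mQ(1) fg(1)] average_weighted_bound[OF w(2) mP(1) fg(2)] ab qr
    by (intro mult_right_mono mult_mono) auto
  also have "\<dots> = ?a * ?b / max ?q ?r"
    using qr by (auto simp: min_def max_def field_simps)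
  also have "\<dots> = form_majorant M \<sigma> \<omega> f g (Q, P)"
    using s by (simp add: form_majorant_def average_def)
  finally show ?thesis .
qed

text \<open>The joint \<open>A\<^sub>p\<close> condition in the form used above; here again the minimum turns into a maximum in the denominator.\<close>
lemma Ap_char_pair:
  fixes \<sigma> \<omega> :: "real ^ 'd \<Rightarrow> real"
  assumes M: "locally_finite_borel M" and D: "dyadic_lattice D"
    and QP: "(Q, P) \<in> \<Gamma>" "Q \<in> D" "P \<in> D" "0 < emeasure M Q" "0 < emeasure M P"
    and w: "weight M \<sigma>" "weight M \<omega>"
  shows "ennreal (measure (weighted M \<omega>) P * measure (weighted M \<sigma>) Q powr (p - 1)
      / max (measure M Q) (measure M P) powr p) \<le> Ap_char M p \<Gamma> \<omega> \<sigma>"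
proof -
  note mQ = dyadic_cube_measure[OF M D QP(2)] and mP = dyadic_cube_measure[OF M D QP(3)]
  let ?q = "measure M Q" and ?r = "measure M P"
  have qr: "0 < ?q" "0 < ?r" using QP mQ(2) mP(2) by (auto intro: measure_positive)
  note wQ = weighted_measure[OF w(1) mQ(1) mQ(4)[OF w(1)]]
  note wP = weighted_measure[OF w(2) mP(1) mP(4)[OF w(2)]]
  have "measure (weighted M \<omega>) P * measure (weighted M \<sigma>) Q powr (p - 1) / max ?q ?r powr p
      = min_measure M Q P powr p / (?q * ?r powr (p - 1)) * avg M \<omega> P * avg M \<sigma> Q powr (p - 1)"
    using Ap_summand_rescale[OF qr, where s = "LINT x:Q|M. \<sigma> x" and W = "LINT x:P|M. \<omega> x" and p = p] wQ(3)[OF QP(4)] qr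
    unfolding wQ(2) wP(2) by (simp add: avg_def min_measure_def)
  also have "ennreal \<dots> \<le> Ap_char M p \<Gamma> \<omega> \<sigma>"
    unfolding Ap_char_def by (rule SUP_upper2[of "(Q, P)"]) (use QP in auto)
  finally show ?thesis .
qed

lemma matched_class_bound:
  fixes M :: "(real ^ 'd) measure" and f g :: "real ^ 'd \<Rightarrow> complex"
  assumes M: "locally_finite_borel M" and D: "dyadic_lattice D" and S: "S \<subseteq> D" "eta_sparse M \<eta> S"
    and \<eta>: "0 < \<eta>" and I: "finite I" "I \<subseteq> form_pairs M S \<Gamma>"
    and near: "\<forall>z\<in>I. \<exists>R. near D \<kappa> (fst z) (snd z) R"
    and matching: "\<And>z w. z \<in> I \<Longrightarrow> w \<in> I \<Longrightarrow> fst z = fst w \<or> snd z = snd w \<Longrightarrow> z = w"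
    and gaps: "\<And>z w. z \<in> I \<Longrightarrow> w \<in> I \<Longrightarrow>
        log_side (fst z) mod (int \<kappa> + 1) = log_side (fst w) mod (int \<kappa> + 1)"
      "\<And>z w. z \<in> I \<Longrightarrow> w \<in> I \<Longrightarrow>
        log_side (snd z) mod (int \<kappa> + 1) = log_side (snd w) mod (int \<kappa> + 1)"
    and w: "weight M \<sigma>" "weight M \<omega>"
    and fg: "in_Lp p (weighted M \<sigma>) f" "in_Lp p' (weighted M \<omega>) g"
    and p: "1 < p" "1 / p + 1 / p' = 1"
    and A: "0 < A" "Ap_char M p \<Gamma> \<omega> \<sigma> \<le> ennreal A"
    and U: "0 < U1" "Ainf_char M D \<sigma> \<le> ennreal U1" "0 < U2" "Ainf_char M D \<omega> \<le> ennreal U2"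
    and pos: "\<And>z. z \<in> I \<Longrightarrow> 0 < average (weighted M \<sigma>) (\<lambda>x. norm (f x)) (fst z)"
      "\<And>z. z \<in> I \<Longrightarrow> 0 < average (weighted M \<omega>) (\<lambda>x. norm (g x)) (snd z)"
  shows "(\<Sum>z\<in>I. form_majorant M \<sigma> \<omega> f g z)
    \<le> (half_const p p' (1 / \<eta>) + half_const p' p (1 / \<eta>)) * A powr (1 / p)
      * ((U1 / \<eta>) powr (1 / p) + (U2 / \<eta>) powr (1 / p'))
      * (Lp_norm p (weighted M \<sigma>) f * Lp_norm p' (weighted M \<omega>) g)"
proof -
  define R where "R z = (SOME R. near D \<kappa> (fst z) (snd z) R)" for z
  have R: "near D \<kappa> (fst z) (snd z) (R z)" if "z \<in> I" for z
    unfolding R_def by (rule someI_ex) (use near that in blast)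
  have IS: "fst z \<in> S" "snd z \<in> S" "z \<in> \<Gamma>" "0 < emeasure M (fst z)" "0 < emeasure M (snd z)" if "z \<in> I" for z
    using I(2) that by (auto simp: form_pairs_def)
  have ID: "fst z \<in> D" "snd z \<in> D" if "z \<in> I" for z using IS[OF that] S(1) by auto
  note cQ = dyadic_cube_measure[OF M D ID(1)] and cP = dyadic_cube_measure[OF M D ID(2)]
  have inj: "inj_on fst I" "inj_on snd I" using matching by (auto intro!: inj_onI)
  note wQ = weighted_measure[OF w(1) cQ(1) cQ(4)[OF _ w(1)]]
  note wP = weighted_measure[OF w(2) cP(1) cP(4)[OF _ w(2)]]
  interpret separated_pairs M "weighted M \<sigma>" "weighted M \<omega>" I fst snd R "\<lambda>x. norm (f x)" "\<lambda>x. norm (g x)"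
    p p' "1 / \<eta>" A "U1 / \<eta>" "U2 / \<eta>"
  proof
    show "finite I" by (rule I(1))
    show "inj_on fst I" "inj_on snd I" by (rule inj)+
    show "laminar (fst ` I \<union> snd ` I)"
      by (rule laminar_subset[OF dyadic_lattice_laminar[OF D]]) (use ID in auto)
    show "sets (weighted M \<sigma>) = sets M" "sets (weighted M \<omega>) = sets M" by simp_all
    show "0 < 1 / \<eta>" using \<eta> by simp
    show "0 < U1 / \<eta>" "0 < U2 / \<eta>" using \<eta> U by simp_all
    show "0 < A" by (rule A(1))
    show "1 < p" "1 / p + 1 / p' = 1" by (rule p)+
    show "(\<lambda>x. norm (f x)) \<in> borel_measurable (weighted M \<sigma>)"
      using fg(1) by (auto simp: in_Lp_def)
    show "(\<lambda>x. norm (g x)) \<in> borel_measurable (weighted M \<omega>)"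
      using fg(2) by (auto simp: in_Lp_def)
    show "integrable (weighted M \<sigma>) (\<lambda>x. norm (f x) powr p)" using fg(1) unfolding in_Lp_def by blast
    show "integrable (weighted M \<omega>) (\<lambda>x. norm (g x) powr p')" using fg(2) unfolding in_Lp_def by blast
    show "0 \<le> norm (f x)" "0 \<le> norm (g x)" for x by simp_all
  next
    fix z assume z: "z \<in> I"
    show "fst z \<in> sets M" "snd z \<in> sets M" by (rule cQ(1)[OF z], rule cP(1)[OF z])
    show "0 < measure M (fst z)" by (rule measure_positive[OF IS(4)[OF z] cQ(2)[OF z]])
    show "0 < measure M (snd z)" by (rule measure_positive[OF IS(5)[OF z] cP(2)[OF z]])
    show "0 < measure (weighted M \<sigma>) (fst z)"
      unfolding wQ(2)[OF z z] by (rule wQ(3)[OF z z IS(4)[OF z]])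
    show "0 < measure (weighted M \<omega>) (snd z)"
      unfolding wP(2)[OF z z] by (rule wP(3)[OF z z IS(5)[OF z]])
    show "fst z \<subseteq> R z" "snd z \<subseteq> R z"
      using R[OF z] dyadic_descendants_subset unfolding near_def by blast+
    show "0 < average (weighted M \<sigma>) (\<lambda>x. norm (f x)) (fst z)" by (rule pos(1)[OF z])
    show "0 < average (weighted M \<omega>) (\<lambda>x. norm (g x)) (snd z)" by (rule pos(2)[OF z])
    let ?m = "max (measure M (fst z)) (measure M (snd z))"
    have m: "0 < ?m" using measure_positive[OF IS(4)[OF z] cQ(2)[OF z]] by simp
    have "ennreal (measure (weighted M \<omega>) (snd z) * measure (weighted M \<sigma>) (fst z) powr (p - 1) / ?m powr p)
        \<le> ennreal A"
      using Ap_char_pair[OF M D _ ID[OF z] IS(4,5)[OF z] w, of \<Gamma> p] IS(3)[OF z] A(2) by force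
    then have "measure (weighted M \<omega>) (snd z) * measure (weighted M \<sigma>) (fst z) powr (p - 1) / ?m powr p \<le> A"
      using A(1) by simp
    then show "measure (weighted M \<omega>) (snd z) * measure (weighted M \<sigma>) (fst z) powr (p - 1) \<le> A * ?m powr p"
      using m by (simp add: pos_divide_le_eq)
  next
    fix z z' assume z: "z \<in> I" "z' \<in> I"
    show "R z \<subseteq> fst z'" if "fst z \<subset> fst z'"
      by (rule near_separated[OF D ID(1)[OF z(1)] ID(1)[OF z(2)] cQ(3)[OF z(1)] that gaps(1)[OF z] R[OF z(1)]])
    show "R z \<subseteq> snd z'" if "snd z \<subset> snd z'"
      by (rule near_separated[OF D ID(2)[OF z(1)] ID(2)[OF z(2)] cP(3)[OF z(1)] that gaps(2)[OF z]
            near_sym[OF R[OF z(1)]]])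
  next
    fix X assume "X \<in> fst ` I \<union> snd ` I"
    then have X: "X \<in> D" using ID by auto
    show "(\<Sum>z\<in>{z \<in> I. fst z \<subseteq> X}. measure M (fst z)) \<le> 1 / \<eta> * measure M X"
      by (rule sparse_packing[OF M D S \<eta> _ _ _ _ X])
        (use I(1) inj IS in \<open>auto intro: inj_on_subset\<close>)
    show "(\<Sum>z\<in>{z \<in> I. snd z \<subseteq> X}. measure M (snd z)) \<le> 1 / \<eta> * measure M X"
      by (rule sparse_packing[OF M D S \<eta> _ _ _ _ X])
        (use I(1) inj IS in \<open>auto intro: inj_on_subset\<close>)
  next
    fix X assume "X \<in> fst ` I"
    then obtain y where y: "y \<in> I" "X = fst y" by auto
    have "(\<Sum>z\<in>{z \<in> I. fst z \<subseteq> X}. LINT x:fst z|M. \<sigma> x) \<le> U1 / \<eta> * (LINT x:X|M. \<sigma> x)"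
    proof (rule Ainf_packing[OF M D S \<eta> _ _ _ _ _ _ _ w(1) U(2)])
      show "inj_on fst {z \<in> I. fst z \<subseteq> X}" by (rule inj_on_subset[OF inj(1)]) auto
      show "X \<in> D" "0 < emeasure M X" using y ID IS by auto
    qed (use I(1) IS U in auto)
    then show "(\<Sum>z\<in>{z \<in> I. fst z \<subseteq> X}. measure (weighted M \<sigma>) (fst z)) \<le> U1 / \<eta> * measure (weighted M \<sigma>) X"
      using wQ(2) y by simp
  next
    fix X assume "X \<in> snd ` I"
    then obtain y where y: "y \<in> I" "X = snd y" by auto
    have "(\<Sum>z\<in>{z \<in> I. snd z \<subseteq> X}. LINT x:snd z|M. \<omega> x) \<le> U2 / \<eta> * (LINT x:X|M. \<omega> x)"
    proof (rule Ainf_packing[OF M D S \<eta> _ _ _ _ _ _ _ w(2) U(4)])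
      show "inj_on snd {z \<in> I. snd z \<subseteq> X}" by (rule inj_on_subset[OF inj(2)]) auto
      show "X \<in> D" "0 < emeasure M X" using y ID IS by auto
    qed (use I(1) IS U in auto)
    then show "(\<Sum>z\<in>{z \<in> I. snd z \<subseteq> X}. measure (weighted M \<omega>) (snd z)) \<le> U2 / \<eta> * measure (weighted M \<omega>) X"
      using wP(2) y by simp
  qed
  have "summand = form_majorant M \<sigma> \<omega> f g"
    by (intro ext) (simp add: summand_def form_majorant_def m_def)
  then show ?thesis using sum_bound unfolding Lp_norm_def by simp
qed

text \<open>
  If the constant vanished, the packing estimate for a single cube would make the weight of that cube
  zero. Positivity rules out products \<open>0 * \<infinity>\<close> on the right-hand side of the main estimate.
\<close>
lemma Ainf_char_pos:
  assumes M: "locally_finite_borel M" and D: "dyadic_lattice D" and S: "S \<subseteq> D" "eta_sparse M \<eta> S"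
    and \<eta>: "0 < \<eta>" and Q: "Q \<in> S" "0 < emeasure M Q" and v: "weight M v"
  shows "0 < Ainf_char M D v"
proof (rule ccontr)
  assume "\<not> 0 < Ainf_char M D v"
  then have U: "Ainf_char M D v \<le> ennreal 0" by simp
  have QD: "Q \<in> D" using Q(1) S(1) by auto
  note mQ = dyadic_cube_measure[OF M D QD]
  have "(\<Sum>i\<in>{Q}. LINT x:i|M. v x) \<le> 0 / \<eta> * (LINT x:Q|M. v x)"
    by (rule Ainf_packing[OF M D S \<eta> _ _ _ _ _ QD Q(2) v U]) (use Q in auto)
  then show False using weighted_measure(3)[OF v mQ(1) mQ(4)[OF v] Q(2)] by simp
qed

lemma Lp_norm_pos:
  assumes f: "in_Lp p N f" and p: "0 < p" and pos: "0 < average N (\<lambda>x. norm (f x)) Q"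
  shows "0 < Lp_norm p N f"
proof -
  have "(LINT x|N. norm (f x) powr p) \<noteq> 0"
  proof
    assume "(LINT x|N. norm (f x) powr p) = 0"
    then have "AE x in N. norm (f x) powr p = 0"
      using f by (subst (asm) integral_nonneg_eq_0_iff_AE) (auto simp: in_Lp_def)
    then have "AE x in N. indicator Q x *\<^sub>R norm (f x) = 0"
      by eventually_elim auto
    then have "(LINT x:Q|N. norm (f x)) = 0"
      unfolding set_lebesgue_integral_def by (rule integral_eq_zero_AE)
    then show False using pos by (simp add: average_def)
  qed
  moreover have "0 \<le> (LINT x|N. norm (f x) powr p)" by (auto intro: integral_nonneg_AE)
  ultimately show ?thesis by (simp add: Lp_norm_def)
qed

text \<open>The number of colours times the constant for one class, with packing constant \<open>1 / \<eta>\<close>.\<close>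
definition form_const :: "'d::finite itself \<Rightarrow> real \<Rightarrow> real \<Rightarrow> real \<Rightarrow> nat \<Rightarrow> real" where
  "form_const d p p' \<eta> \<kappa> = real ((Suc \<kappa> * near_bound d \<kappa>) ^ 2)
     * (half_const p p' (1 / \<eta>) + half_const p' p (1 / \<eta>)) / \<eta>"

lemma form_const_pos:
  assumes "1 < p" "1 < p'" "0 < \<eta>"
  shows "0 < form_const TYPE('d::finite) p p' \<eta> \<kappa>"
proof -
  have "0 < near_bound TYPE('d) \<kappa>" by (simp add: near_bound_def)
  then have "0 < (Suc \<kappa> * near_bound TYPE('d) \<kappa>) ^ 2" by simp
  then have "0 < real ((Suc \<kappa> * near_bound TYPE('d) \<kappa>) ^ 2)" by (simp only: of_nat_0_less_iff)
  moreover have "0 < half_const p p' (1 / \<eta>) + half_const p' p (1 / \<eta>)"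
    using assms by (intro add_pos_pos half_const_pos) auto
  ultimately show ?thesis unfolding form_const_def
    using assms(3) by (intro divide_pos_pos mult_pos_pos)
qed

lemma rescaled_power_le:
  fixes U \<eta> r :: real
  assumes "0 < \<eta>" "\<eta> < 1" "1 < r" "0 < U"
  shows "(U / \<eta>) powr (1 / r) \<le> U powr (1 / r) / \<eta>"
proof -
  have "\<eta> powr 1 \<le> \<eta> powr (1 / r)"
    using assms by (intro powr_mono') auto
  then have "U powr (1 / r) / \<eta> powr (1 / r) \<le> U powr (1 / r) / \<eta>"
    using assms by (intro divide_left_mono) auto
  then show ?thesis using assms by (simp add: powr_divide)
qed

text \<open>
  Pairs with vanishing majorant are discarded first, since stopping cubes are defined through the
  logarithms of the averages, which have to be positive.
\<close>
lemma finite_form_bound: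
  fixes M :: "(real ^ 'd) measure" and f g :: "real ^ 'd \<Rightarrow> complex"
  assumes M: "locally_finite_borel M" and D: "dyadic_lattice D" and S: "S \<subseteq> D" "eta_sparse M \<eta> S"
    and \<Gamma>: "\<Gamma> \<subseteq> D \<times> D" "complexity_at_most D \<Gamma> \<kappa>"
    and \<eta>: "0 < \<eta>" "\<eta> < 1" and I: "finite I" "I \<subseteq> form_pairs M S \<Gamma>"
    and w: "weight M \<sigma>" "weight M \<omega>"
    and fg: "in_Lp p (weighted M \<sigma>) f" "in_Lp p' (weighted M \<omega>) g"
    and p: "1 < p" "1 / p + 1 / p' = 1"
    and A: "0 < A" "Ap_char M p \<Gamma> \<omega> \<sigma> \<le> ennreal A"
    and U: "0 < U1" "Ainf_char M D \<sigma> \<le> ennreal U1" "0 < U2" "Ainf_char M D \<omega> \<le> ennreal U2"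
  shows "(\<Sum>z\<in>I. form_majorant M \<sigma> \<omega> f g z)
    \<le> form_const TYPE('d) p p' \<eta> \<kappa> * A powr (1 / p) * (U1 powr (1 / p) + U2 powr (1 / p'))
      * (Lp_norm p (weighted M \<sigma>) f * Lp_norm p' (weighted M \<omega>) g)"
proof -
  let ?h = "form_majorant M \<sigma> \<omega> f g" and ?N = "near_bound TYPE('d) \<kappa>"
  let ?n = "Lp_norm p (weighted M \<sigma>) f * Lp_norm p' (weighted M \<omega>) g"
  let ?H = "half_const p p' (1 / \<eta>) + half_const p' p (1 / \<eta>)"
  let ?V = "U1 powr (1 / p) + U2 powr (1 / p')"
  note p' = conjugate_exponent(1)[OF p]
  have n: "0 \<le> ?n" by (simp add: Lp_norm_def)
  have H: "0 < ?H" using p p' \<eta> by (intro add_pos_pos half_const_pos) auto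
  define J where "J = {z \<in> I. ?h z \<noteq> 0}"
  have J: "finite J" "J \<subseteq> I" "J \<subseteq> form_pairs M S \<Gamma>" using I by (auto simp: J_def)
  have near: "\<forall>z\<in>J. \<exists>R. near D \<kappa> (fst z) (snd z) R"
    using J(3) near_of_complexity[OF D \<Gamma>] by (auto simp: form_pairs_def)
  have JD: "J \<subseteq> D \<times> D" using J(3) S(1) by (auto simp: form_pairs_def)
  have pos: "0 < average (weighted M \<sigma>) (\<lambda>x. norm (f x)) (fst z)"
    "0 < average (weighted M \<omega>) (\<lambda>x. norm (g x)) (snd z)" if "z \<in> J" for z
    using that average_nonneg[of "\<lambda>x. norm (f x)" "weighted M \<sigma>" "fst z"]
      average_nonneg[of "\<lambda>x. norm (g x)" "weighted M \<omega>" "snd z"]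
    by (auto simp: J_def form_majorant_def less_le)
  let ?C = "({0..int \<kappa>} \<times> {0..int \<kappa>}) \<times> {..<?N} \<times> {..<?N}"
  obtain col :: "(real ^ 'd) set \<times> (real ^ 'd) set \<Rightarrow> (int \<times> int) \<times> nat \<times> nat" where
    col: "col ` J \<subseteq> ?C" and sepd: "\<forall>z\<in>J. \<forall>w\<in>J. col z = col w \<longrightarrow>
       (fst z = fst w \<or> snd z = snd w \<longrightarrow> z = w) \<and>
       log_side (fst z) mod (int \<kappa> + 1) = log_side (fst w) mod (int \<kappa> + 1) \<and>
       log_side (snd z) mod (int \<kappa> + 1) = log_side (snd w) mod (int \<kappa> + 1)"
    using separated_colouring[OF D J(1) JD near] by (elim exE conjE)
  let ?B = "?H * A powr (1 / p) * (?V / \<eta>) * ?n"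
  have class_le: "(\<Sum>z\<in>{z \<in> J. col z = c}. ?h z) \<le> ?B" for c
  proof -
    have "(\<Sum>z\<in>{z \<in> J. col z = c}. ?h z)
        \<le> ?H * A powr (1 / p) * ((U1 / \<eta>) powr (1 / p) + (U2 / \<eta>) powr (1 / p')) * ?n"
    proof (rule matched_class_bound[where D = D and S = S and \<Gamma> = \<Gamma> and \<kappa> = \<kappa>])
      show "finite {z \<in> J. col z = c}" "{z \<in> J. col z = c} \<subseteq> form_pairs M S \<Gamma>" using J by auto
      show "\<forall>z\<in>{z \<in> J. col z = c}. \<exists>R. near D \<kappa> (fst z) (snd z) R" using near by blast
      fix z w assume zw: "z \<in> {z \<in> J. col z = c}" "w \<in> {z \<in> J. col z = c}"
      then have zw': "z \<in> J" "w \<in> J" "col z = col w" by auto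
      note sep = sepd[rule_format, OF zw']
      show "z = w" if "fst z = fst w \<or> snd z = snd w" using sep that by blast
      show "log_side (fst z) mod (int \<kappa> + 1) = log_side (fst w) mod (int \<kappa> + 1)" using sep by blast
      show "log_side (snd z) mod (int \<kappa> + 1) = log_side (snd w) mod (int \<kappa> + 1)" using sep by blast
    next
      fix z assume "z \<in> {z \<in> J. col z = c}"
      then have z: "z \<in> J" by auto
      show "0 < average (weighted M \<sigma>) (\<lambda>x. norm (f x)) (fst z)" by (rule pos(1)[OF z])
      show "0 < average (weighted M \<omega>) (\<lambda>x. norm (g x)) (snd z)" by (rule pos(2)[OF z])
    qed (rule M D S \<eta> w fg p A U)+
    also have "\<dots> \<le> ?B"
    proof (intro mult_right_mono mult_left_mono)
      show "(U1 / \<eta>) powr (1 / p) + (U2 / \<eta>) powr (1 / p') \<le> ?V / \<eta>"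
        unfolding add_divide_distrib by (intro add_mono rescaled_power_le \<eta> p p' U)
    qed (use n H in auto)
    finally show ?thesis .
  qed
  have "(\<Sum>z\<in>I. ?h z) = (\<Sum>z\<in>J. ?h z)"
    using I(1) by (intro sum.mono_neutral_right) (auto simp: J_def)
  also have "\<dots> \<le> real (card ?C) * ?B"
  proof (rule sum_colour_classes_le[OF J(1) _ col _ class_le])
    show "0 \<le> ?B" using n H \<eta> by (intro mult_nonneg_nonneg) (auto simp: Lp_norm_def)
  qed simp
  also have "card ?C = (Suc \<kappa> * ?N) ^ 2"
    by (simp add: card_cartesian_product power2_eq_square algebra_simps nat_add_distrib)
  finally show ?thesis by (simp add: form_const_def mult_ac)
qed

lemma ennreal_powr_pos: "0 < x \<Longrightarrow> 0 < ennreal_powr x r"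
  by (cases x) (auto simp: ennreal_powr_def)

lemma ennreal_powr_finite:
  assumes "ennreal_powr x r < \<infinity>"
  shows "x = ennreal (enn2real x)" "ennreal_powr x r = ennreal (enn2real x powr r)"
  using assms by (auto simp: ennreal_powr_def ennreal_enn2real_if split: if_splits)

lemma ennreal_factors_finite:
  fixes c a u m n :: ennreal
  assumes "c * a * u * m * n < \<infinity>" "0 < c" "0 < a" "0 < u" "0 < m" "0 < n"
  shows "a < \<infinity>" "u < \<infinity>"
proof -
  have "a \<noteq> \<infinity> \<and> u \<noteq> \<infinity>"
    using assms unfolding less_top[symmetric] infinity_ennreal_def zero_less_iff_neq_zero
    by (simp add: ennreal_mult_eq_top_iff)
  then show "a < \<infinity>" "u < \<infinity>" by (simp_all add: less_top[symmetric])
qed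

theorem theorem6:
  fixes p p' \<eta> :: real and \<kappa> :: nat
  assumes "1 < p" and "1 / p + 1 / p' = 1" and "0 < \<eta>" and "\<eta> < 1"
  shows "\<exists>C::real. 0 < C \<and>
    (\<forall>(M :: (real ^ 'd) measure) D S \<Gamma> \<sigma> \<omega> f g.
       locally_finite_borel M \<longrightarrow>
       dyadic_lattice D \<longrightarrow>
       S \<subseteq> D \<longrightarrow> eta_sparse M \<eta> S \<longrightarrow>
       \<Gamma> \<subseteq> D \<times> D \<longrightarrow> complexity_at_most D \<Gamma> \<kappa> \<longrightarrow>
       weight M \<sigma> \<longrightarrow> weight M \<omega> \<longrightarrow>
       in_Lp p (weighted M \<sigma>) f \<longrightarrow> in_Lp p' (weighted M \<omega>) g \<longrightarrow>
       (let F = (\<lambda>x. f x * of_real (\<sigma> x));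
            G = (\<lambda>x. g x * of_real (\<omega> x));
            B = ennreal C * ennreal_powr (Ap_char M p \<Gamma> \<omega> \<sigma>) (1 / p)
                * (ennreal_powr (Ainf_char M D \<sigma>) (1 / p)
                   + ennreal_powr (Ainf_char M D \<omega>) (1 / p'))
                * ennreal (Lp_norm p (weighted M \<sigma>) f)
                * ennreal (Lp_norm p' (weighted M \<omega>) g)
        in (B < \<infinity> \<longrightarrow> (\<lambda>z. norm (form_term M F G z)) summable_on form_pairs M S \<Gamma>) \<and>
           ennreal (cmod (sparse_form M S \<Gamma> F G)) \<le> B))"
proof -
  note p = assms(1,2) and \<eta> = assms(3,4)
  note p' = conjugate_exponent(1)[OF p]
  define C where "C = form_const TYPE('d) p p' \<eta> \<kappa>"
  have C: "0 < C" unfolding C_def by (rule form_const_pos[OF p(1) p' \<eta>(1)])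
  show ?thesis
  proof (intro exI[of _ C] conjI allI impI, rule C)
    fix M :: "(real ^ 'd) measure" and D S \<Gamma> \<sigma> \<omega> f g
    assume M: "locally_finite_borel M" and D: "dyadic_lattice D" and S: "S \<subseteq> D" "eta_sparse M \<eta> S"
      and \<Gamma>: "\<Gamma> \<subseteq> D \<times> D" "complexity_at_most D \<Gamma> \<kappa>"
      and w: "weight M \<sigma>" "weight M \<omega>"
      and fg: "in_Lp p (weighted M \<sigma>) f" "in_Lp p' (weighted M \<omega>) g"
    define F where "F = (\<lambda>x. f x * of_real (\<sigma> x))"
    define G where "G = (\<lambda>x. g x * of_real (\<omega> x))"
    define a where "a = Ap_char M p \<Gamma> \<omega> \<sigma>"
    define u1 where "u1 = Ainf_char M D \<sigma>"
    define u2 where "u2 = Ainf_char M D \<omega>"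
    define n1 where "n1 = Lp_norm p (weighted M \<sigma>) f"
    define n2 where "n2 = Lp_norm p' (weighted M \<omega>) g"
    define B where "B = ennreal C * ennreal_powr a (1 / p)
      * (ennreal_powr u1 (1 / p) + ennreal_powr u2 (1 / p')) * ennreal n1 * ennreal n2"
    let ?X = "form_pairs M S \<Gamma>"
    let ?h = "form_majorant M \<sigma> \<omega> f g"
    have fgM: "f \<in> borel_measurable M" "g \<in> borel_measurable M"
      using fg by (auto simp: in_Lp_def)
    have le_h: "norm (form_term M F G z) \<le> ?h z" if "z \<in> ?X" for z
    proof -
      obtain Q P where z: "z = (Q, P)" by (cases z)
      have "Q \<in> D" "P \<in> D" "0 < emeasure M Q" "0 < emeasure M P"
        using that S(1) by (auto simp: z form_pairs_def)
      then show ?thesis unfolding z F_def G_def by (rule form_term_le_majorant[OF M D _ _ _ _ w fgM])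
    qed
    have main: "(\<lambda>z. norm (form_term M F G z)) summable_on ?X \<and> ennreal (cmod (sparse_form M S \<Gamma> F G)) \<le> B"
      if B: "B < \<infinity>"
    proof -
      \<comment> \<open>
        A single nonzero summand forces all factors of \<open>B\<close> to be positive, so that finiteness of \<open>B\<close>
        makes each of them finite and the estimate in real numbers applies.\<close>
      have bound: "ennreal (\<Sum>z\<in>I. ?h z) \<le> B" if I: "finite I" "I \<subseteq> ?X" for I
      proof (cases "\<exists>z\<in>I. ?h z \<noteq> 0")
        case False
        then have "(\<Sum>z\<in>I. ?h z) = 0" by (intro sum.neutral) auto
        then show ?thesis by simp
      next
        case True
        then obtain z where z: "z \<in> I" "?h z \<noteq> 0" by blast
        obtain Q P where QP: "z = (Q, P)" by (cases z)
        have zX: "(Q, P) \<in> \<Gamma>" "Q \<in> S" "P \<in> S" "0 < emeasure M Q" "0 < emeasure M P"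
          using z(1) I(2) by (auto simp: QP form_pairs_def)
        have zD: "Q \<in> D" "P \<in> D" using zX S(1) by auto
        note mQ = dyadic_cube_measure[OF M D zD(1)] and mP = dyadic_cube_measure[OF M D zD(2)]
        have n1: "0 < n1" unfolding n1_def
        proof (rule Lp_norm_pos[OF fg(1)])
          show "0 < average (weighted M \<sigma>) (\<lambda>x. norm (f x)) Q"
            using z(2) average_nonneg[of "\<lambda>x. norm (f x)" "weighted M \<sigma>" Q]
            by (auto simp: QP form_majorant_def less_le)
        qed (use p in auto)
        have n2: "0 < n2" unfolding n2_def
        proof (rule Lp_norm_pos[OF fg(2)])
          show "0 < average (weighted M \<omega>) (\<lambda>x. norm (g x)) P"
            using z(2) average_nonneg[of "\<lambda>x. norm (g x)" "weighted M \<omega>" P]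
            by (auto simp: QP form_majorant_def less_le)
        qed (use p' in auto)
        have u: "0 < u1" "0 < u2"
          unfolding u1_def u2_def by (rule Ainf_char_pos[OF M D S \<eta>(1) zX(2,4)]; rule w)+
        have a: "0 < a"
        proof -
          have "0 < measure (weighted M \<omega>) P * measure (weighted M \<sigma>) Q powr (p - 1)
              / max (measure M Q) (measure M P) powr p"
            using weighted_measure(2,3)[OF w(1) mQ(1) mQ(4)[OF w(1)]]
              weighted_measure(2,3)[OF w(2) mP(1) mP(4)[OF w(2)]] zX(4,5)
              measure_positive[OF zX(4) mQ(2)]
            by (intro divide_pos_pos mult_pos_pos) (auto simp: less_max_iff_disj)
          then have "0 < ennreal (measure (weighted M \<omega>) P * measure (weighted M \<sigma>) Q powr (p - 1)
              / max (measure M Q) (measure M P) powr p)" by simp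
          also have "\<dots> \<le> a" unfolding a_def by (rule Ap_char_pair[OF M D zX(1) zD zX(4,5) w])
          finally show ?thesis .
        qed
        let ?a = "ennreal_powr a (1 / p)" and ?u = "ennreal_powr u1 (1 / p) + ennreal_powr u2 (1 / p')"
        have "0 < ?a" "0 < ?u" using a u by (auto intro: ennreal_powr_pos add_pos_pos)
        then have fin: "?a < \<infinity>" "?u < \<infinity>"
          using ennreal_factors_finite[OF B[unfolded B_def]] C n1 n2 by simp_all
        then have fin': "ennreal_powr u1 (1 / p) < \<infinity>" "ennreal_powr u2 (1 / p') < \<infinity>" by auto
        note fa = ennreal_powr_finite[OF fin(1)]
          and fu1 = ennreal_powr_finite[OF fin'(1)] and fu2 = ennreal_powr_finite[OF fin'(2)]
        have pos: "0 < enn2real a" "0 < enn2real u1" "0 < enn2real u2"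
          using a u fa(1) fu1(1) fu2(1) by (metis ennreal_less_zero_iff)+
        have "(\<Sum>z\<in>I. ?h z) \<le> C * enn2real a powr (1 / p)
            * (enn2real u1 powr (1 / p) + enn2real u2 powr (1 / p')) * (n1 * n2)"
          unfolding C_def n1_def n2_def
          by (rule finite_form_bound[OF M D S \<Gamma> \<eta> I w fg p pos(1) _ pos(2) _ pos(3)])
            (use fa(1) fu1(1) fu2(1) in \<open>simp_all add: a_def u1_def u2_def\<close>)
        then have "ennreal (\<Sum>z\<in>I. ?h z) \<le> ennreal (C * enn2real a powr (1 / p)
            * (enn2real u1 powr (1 / p) + enn2real u2 powr (1 / p')) * (n1 * n2))"
          by (rule ennreal_leI)
        also have "\<dots> = B"
          unfolding B_def fa(2) fu1(2) fu2(2) using C n1 n2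
          by (simp add: ennreal_mult ennreal_plus[symmetric] mult.assoc del: ennreal_plus)
        finally show ?thesis .
      qed
      have Breal: "B = ennreal (enn2real B)" using B by (simp add: ennreal_enn2real_if)
      have sum_le: "(\<Sum>z\<in>I. norm (form_term M F G z)) \<le> enn2real B" if I: "finite I" "I \<subseteq> ?X" for I
      proof -
        have "(\<Sum>z\<in>I. norm (form_term M F G z)) \<le> (\<Sum>z\<in>I. ?h z)"
          by (rule sum_mono) (use le_h I(2) in auto)
        also have "\<dots> \<le> enn2real B"
          using bound[OF I] Breal by (metis ennreal_le_iff enn2real_nonneg)
        finally show ?thesis .
      qed
      have summ: "(\<lambda>z. norm (form_term M F G z)) summable_on ?X"
      proof (rule nonneg_bdd_above_summable_on)
        show "bdd_above (sum (\<lambda>z. norm (form_term M F G z)) ` {I. I \<subseteq> ?X \<and> finite I})"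
          by (rule bdd_aboveI[of _ "enn2real B"]) (use sum_le in auto)
      qed auto
      have "cmod (sparse_form M S \<Gamma> F G) \<le> (\<Sum>\<^sub>\<infinity>z\<in>?X. norm (form_term M F G z))"
        unfolding sparse_form_def by (rule norm_infsum_bound[OF summ])
      also have "\<dots> \<le> enn2real B" by (rule infsum_le_finite_sums[OF summ]) (rule sum_le)
      finally have "ennreal (cmod (sparse_form M S \<Gamma> F G)) \<le> ennreal (enn2real B)" by (rule ennreal_leI)
      then show ?thesis using summ Breal by simp
    qed
    have "ennreal (cmod (sparse_form M S \<Gamma> F G)) \<le> B"
      using main by (cases "B < \<infinity>") (auto simp: less_top[symmetric])
    then show "let F = (\<lambda>x. f x * of_real (\<sigma> x));
            G = (\<lambda>x. g x * of_real (\<omega> x));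
            B = ennreal C * ennreal_powr (Ap_char M p \<Gamma> \<omega> \<sigma>) (1 / p)
                * (ennreal_powr (Ainf_char M D \<sigma>) (1 / p)
                   + ennreal_powr (Ainf_char M D \<omega>) (1 / p'))
                * ennreal (Lp_norm p (weighted M \<sigma>) f)
                * ennreal (Lp_norm p' (weighted M \<omega>) g)
        in (B < \<infinity> \<longrightarrow> (\<lambda>z. norm (form_term M F G z)) summable_on form_pairs M S \<Gamma>) \<and>
           ennreal (cmod (sparse_form M S \<Gamma> F G)) \<le> B"
      using main unfolding Let_def F_def G_def B_def a_def u1_def u2_def n1_def n2_def by blast
  qed
qed

end
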